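(* Suppose fundamentals $w_i$ are independent and errors $e_i$ are perfectly correlated ($e_i=e$ for all $i$). For sufficiently large $\sigma$, data sharing increases social surplus, $\Delta W_i(X)>0$. However, because the fundamentals are independent, data intermediation is never profitable, $R(X)<0$. These conclusions hold whether the intermediary collects complete data ($X=S$) or anonymized data ($X=A$).
   Context: There are many consumers $i=1,\dots,N$, with $N\ge2$. Consumer $i$ observes $s_i=w_i+\sigma e$, where the $w_i$ (willingness to pay) are independent and identically distributed with mean $\mu$ and variance $1$, the common error $e$ has mean $0$ and variance $1$ and is independent of $(w_1,\dots,w_N)$, and $\sigma>0$; the distributions are otherwise arbitrary. $S_i$ denotes the information $s_i$. Inflow policies: complete data $X=S=(s_1,\dots,s_N)$, with $X_{-i}=S_{-i}=(s_j)_{j\ne i}$; anonymized data $X=A$, a uniformly random permutation (independent of everything else) of the entries of $S$, with $X_{-i}=A_{-i}$ a uniformly random permutation of the entries of $S_{-i}$. $\varnothing$ denotes no information. Product market: facing unit price $p_i$, consumer $i$ buys $q_i$ with utility $w_iq_i-p_iq_i-\tfrac12q_i^2$; the producer's profit from $i$ is $(p_i-c)q_i$, $c\ge 0$. When consumer $i$ has information $I$ and the producer has information $Y_0$ (no finer than $I$), $p_i^*=\tfrac12(\mathbb E[w_i\mid Y_0]+c)$, $q_i^*=\mathbb E[w_i\mid I]-p_i^*$; $\Pi_i(I,Y_0)=\mathbb E[(p_i^*-c)q_i^*]$, $U_i(I,Y_0)=\mathbb E[w_iq_i^*-p_i^*q_i^*-\tfrac12(q_i^* )^2]$, $W_i=\Pi_i+U_i$.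 Effect of sharing on social surplus: $\Delta W_i(X)=W_i((S_i,X),X)-W_i(S_i,\varnothing)$. The intermediary's profit is $R(X)=\sum_i\big(\Pi_i((S_i,X),X)-\Pi_i(S_i,\varnothing)\big)-\sum_i\big(U_i((S_i,X_{-i}),X_{-i})-U_i((S_i,X),X)\big)$; intermediation with $X$ is profitable when $R(X)\ge0$.
   Formalization: For the claim that data sharing increases social surplus for large σ, the common error e is additionally assumed to have a density; without this it fails, e.g. for fair-sign w_i and e, where s_i reveals w_i once σ>1. R(X)<0 is stated for all distributions. *)

theory Defs
  imports "HOL-Probability.Probability"
begin

text \<open>
  Consumers are indexed by \<open>i < N\<close>. Given a finite set \<open>B\<close> of consumers, \<open>\<pi> B\<close> is the
  random permutation of \<open>B\<close> used to anonymize the signals of the consumers in \<open>B\<close>: the set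
  \<open>{..<N}\<close> serves for \<open>A\<close>, and \<open>{..<N} - {i}\<close> for \<open>A\<^sub>-\<^sub>i\<close>. The joint law of these
  permutations is left unrestricted, since no information set contains two of them.

  The laws of \<open>w i\<close> and \<open>e\<close> are arbitrary here. For a surplus gain at large \<open>\<sigma>\<close> the signal
  \<open>w i + \<sigma> e\<close> has to become uninformative as \<open>\<sigma>\<close> grows. This can fail when \<open>e\<close> has no density:
  if \<open>w i\<close> and \<open>e\<close> are fair signs, then for \<open>\<sigma> > 1\<close> the signal reveals \<open>w i\<close>, and the gain from complete data
  is \<open>-1/8\<close>.
\<close>

locale social_data = prob_space M
  for M :: "'a measure" +
  fixes N :: nat and w :: "nat \<Rightarrow> 'a \<Rightarrow> real" and e :: "'a \<Rightarrow> real"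
    and \<pi> :: "nat set \<Rightarrow> 'a \<Rightarrow> nat \<Rightarrow> nat" and \<mu> c :: real
  assumes two_consumers: "N \<ge> 2"
    and cost_nonneg: "c \<ge> 0"
    and w_indep: "indep_vars (\<lambda>_. borel) w {..<N}"
    and w_ident: "\<And>i j. i < N \<Longrightarrow> j < N \<Longrightarrow> distr M borel (w i) = distr M borel (w j)"
    and w_square_integrable: "\<And>i. i < N \<Longrightarrow> integrable M (\<lambda>\<omega>. (w i \<omega>)\<^sup>2)"
    and w_mean: "\<And>i. i < N \<Longrightarrow> expectation (w i) = \<mu>"
    and w_variance: "\<And>i. i < N \<Longrightarrow> variance (w i) = 1"
    and e_rv: "random_variable borel e"
    and e_square_integrable: "integrable M (\<lambda>\<omega>. (e \<omega>)\<^sup>2)"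
    and e_mean: "expectation e = 0"
    and e_variance: "variance e = 1"
    and e_indep_w:
      "indep_set
        (sets (vimage_algebra (space M) e borel))
        (sets (vimage_algebra (space M) (\<lambda>\<omega>. \<lambda>i\<in>{..<N}. w i \<omega>) (\<Pi>\<^sub>M i\<in>{..<N}. borel)))"
    and perm_rv:
      "\<And>B. B = {..<N} \<or> (\<exists>i<N. B = {..<N} - {i}) \<Longrightarrow>
        random_variable (count_space {p. p permutes B}) (\<pi> B)"
    and perm_uniform:
      "\<And>B. B = {..<N} \<or> (\<exists>i<N. B = {..<N} - {i}) \<Longrightarrow>
        distr M (count_space {p. p permutes B}) (\<pi> B) = uniform_count_measure {p. p permutes B}"
    and perm_indep:
      "\<And>B. B = {..<N} \<or> (\<exists>i<N. B = {..<N} - {i}) \<Longrightarrow>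
        indep_set
          (sets (vimage_algebra (space M) (\<pi> B) (count_space {p. p permutes B})))
          (sets (vimage_algebra (space M) (\<lambda>\<omega>. (e \<omega>, \<lambda>i\<in>{..<N}. w i \<omega>))
            (borel \<Otimes>\<^sub>M (\<Pi>\<^sub>M i\<in>{..<N}. borel))))"

definition signal :: "(nat \<Rightarrow> 'a \<Rightarrow> real) \<Rightarrow> ('a \<Rightarrow> real) \<Rightarrow> real \<Rightarrow> nat \<Rightarrow> 'a \<Rightarrow> real" where
  "signal w e \<sigma> i \<omega> = w i \<omega> + \<sigma> * e \<omega>"

text \<open>
  An inflow policy \<open>X\<close> assigns to a set \<open>B\<close> of consumers the data vector collected from \<open>B\<close>,
  indexed by \<open>B\<close>: the full inflow is \<open>X {..<N}\<close>, and \<open>X\<^sub>-\<^sub>i\<close> is \<open>X ({..<N} - {i})\<close>.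
\<close>

definition complete_data :: "(nat \<Rightarrow> 'a \<Rightarrow> real) \<Rightarrow> nat set \<Rightarrow> 'a \<Rightarrow> nat \<Rightarrow> real" where
  "complete_data s B \<omega> = (\<lambda>j\<in>B. s j \<omega>)"

definition anonymized_data ::
  "(nat set \<Rightarrow> 'a \<Rightarrow> nat \<Rightarrow> nat) \<Rightarrow> (nat \<Rightarrow> 'a \<Rightarrow> real) \<Rightarrow> nat set \<Rightarrow> 'a \<Rightarrow> nat \<Rightarrow> real"
where
  "anonymized_data \<pi> s B \<omega> = (\<lambda>j\<in>B. s (\<pi> B \<omega> j) \<omega>)"

text \<open>
  Information is a sub-\<open>\<sigma>\<close>-algebra of \<open>M\<close>, represented by a measure on \<open>space M\<close> of which
  only the measurable sets matter.
\<close>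

definition no_info :: "'a measure \<Rightarrow> 'a measure" where
  "no_info M = sigma (space M) {}"

definition own_info :: "'a measure \<Rightarrow> (nat \<Rightarrow> 'a \<Rightarrow> real) \<Rightarrow> nat \<Rightarrow> 'a measure" where
  "own_info M s i = vimage_algebra (space M) (s i) borel"

definition data_info ::
  "'a measure \<Rightarrow> (nat set \<Rightarrow> 'a \<Rightarrow> nat \<Rightarrow> real) \<Rightarrow> nat set \<Rightarrow> 'a measure"
where
  "data_info M X B = vimage_algebra (space M) (X B) (\<Pi>\<^sub>M j\<in>B. borel)"

definition joint_info ::
  "'a measure \<Rightarrow> (nat \<Rightarrow> 'a \<Rightarrow> real) \<Rightarrow> (nat set \<Rightarrow> 'a \<Rightarrow> nat \<Rightarrow> real) \<Rightarrow> nat \<Rightarrow> nat set \<Rightarrow> 'a measure"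
where
  "joint_info M s X i B =
    vimage_algebra (space M) (\<lambda>\<omega>. (s i \<omega>, X B \<omega>)) (borel \<Otimes>\<^sub>M (\<Pi>\<^sub>M j\<in>B. borel))"

text \<open>
  Below, \<open>v\<close> is the willingness to pay of one consumer, \<open>I\<close> this consumer's information and
  \<open>Y\<close> the producer's.
\<close>

definition price :: "'a measure \<Rightarrow> real \<Rightarrow> ('a \<Rightarrow> real) \<Rightarrow> 'a measure \<Rightarrow> 'a \<Rightarrow> real" where
  "price M c v Y \<omega> = (real_cond_exp M Y v \<omega> + c) / 2"

definition demand ::
  "'a measure \<Rightarrow> real \<Rightarrow> ('a \<Rightarrow> real) \<Rightarrow> 'a measure \<Rightarrow> 'a measure \<Rightarrow> 'a \<Rightarrow> real"
where
  "demand M c v I Y \<omega> = real_cond_exp M I v \<omega> - price M c v Y \<omega>"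

definition producer_surplus ::
  "'a measure \<Rightarrow> real \<Rightarrow> ('a \<Rightarrow> real) \<Rightarrow> 'a measure \<Rightarrow> 'a measure \<Rightarrow> real"
where
  "producer_surplus M c v I Y =
    (\<integral>\<omega>. (price M c v Y \<omega> - c) * demand M c v I Y \<omega> \<partial>M)"

definition consumer_surplus ::
  "'a measure \<Rightarrow> real \<Rightarrow> ('a \<Rightarrow> real) \<Rightarrow> 'a measure \<Rightarrow> 'a measure \<Rightarrow> real"
where
  "consumer_surplus M c v I Y =
    (\<integral>\<omega>. v \<omega> * demand M c v I Y \<omega> - price M c v Y \<omega> * demand M c v I Y \<omega>
      - (demand M c v I Y \<omega>)\<^sup>2 / 2 \<partial>M)"

definition social_surplus ::
  "'a measure \<Rightarrow> real \<Rightarrow> ('a \<Rightarrow> real) \<Rightarrow> 'a measure \<Rightarrow> 'a measure \<Rightarrow> real"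
where
  "social_surplus M c v I Y = producer_surplus M c v I Y + consumer_surplus M c v I Y"

text \<open>In the next two definitions \<open>s\<close> is the family of signals and \<open>X\<close> the inflow policy.\<close>

definition social_surplus_gain ::
  "'a measure \<Rightarrow> nat \<Rightarrow> real \<Rightarrow> (nat \<Rightarrow> 'a \<Rightarrow> real) \<Rightarrow> (nat \<Rightarrow> 'a \<Rightarrow> real) \<Rightarrow>
    (nat set \<Rightarrow> 'a \<Rightarrow> nat \<Rightarrow> real) \<Rightarrow> nat \<Rightarrow> real"
where
  "social_surplus_gain M N c w s X i =
    social_surplus M c (w i) (joint_info M s X i {..<N}) (data_info M X {..<N})
    - social_surplus M c (w i) (own_info M s i) (no_info M)"

definition intermediary_profit ::
  "'a measure \<Rightarrow> nat \<Rightarrow> real \<Rightarrow> (nat \<Rightarrow> 'a \<Rightarrow> real) \<Rightarrow> (nat \<Rightarrow> 'a \<Rightarrow> real) \<Rightarrow>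
    (nat set \<Rightarrow> 'a \<Rightarrow> nat \<Rightarrow> real) \<Rightarrow> real"
where
  "intermediary_profit M N c w s X =
    (\<Sum>i<N. producer_surplus M c (w i) (joint_info M s X i {..<N}) (data_info M X {..<N})
            - producer_surplus M c (w i) (own_info M s i) (no_info M))
    - (\<Sum>i<N. consumer_surplus M c (w i) (joint_info M s X i ({..<N} - {i}))
                 (data_info M X ({..<N} - {i}))
              - consumer_surplus M c (w i) (joint_info M s X i {..<N}) (data_info M X {..<N}))"

end

theory Submission
  imports Defs
begin

text \<open>
  Write \<open>V F = E (E[w i | F])\<^sup>2\<close>. Expanding the definitions, \<open>\<Pi> = V Y / 4\<close> and \<open>U = V I / 2 - 3/8 V Y\<close> up to terms
  that do not depend on the information, so both claims are statements about \<open>V\<close>, and \<open>V F\<close> is the maximum of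
  \<open>2 E[w i Z] - E Z\<^sup>2\<close> over square integrable \<open>F\<close>-measurable \<open>Z\<close>.

  Profit: \<open>V(X\<^sub>-\<^sub>i) = \<mu>\<^sup>2\<close> by independence, and \<open>V X > \<mu>\<^sup>2\<close> because \<open>w i\<close> is correlated with the total of the
  signals. Moreover \<open>V(S\<^sub>i, X) \<le> V(S\<^sub>i, X\<^sub>-\<^sub>i)\<close>: for anonymized data, averaging an estimator over the permutation
  gives at least as good an estimator that is a symmetric function of all signals, and \<open>S\<^sub>i\<close> and \<open>A\<^sub>-\<^sub>i\<close> determine
  its value. Hence \<open>R\<close> is at most the sum over \<open>i\<close> of \<open>(\<mu>\<^sup>2 - V X) / 8\<close>.

  Surplus: \<open>S\<^sub>i\<close> and \<open>X\<close> together reveal \<open>w i\<close> minus the average fundamental, the common error cancelling, so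
  \<open>V(S\<^sub>i, X) \<ge> \<mu>\<^sup>2 + 1 - 1/N\<close> for every \<open>\<sigma>\<close>, while \<open>V S\<^sub>i\<close> tends to \<open>\<mu>\<^sup>2\<close>: the density \<open>g\<close> of \<open>e\<close> satisfies
  \<open>\<integral> \<bar>g (x - y / \<sigma>) - g x\<bar> dx \<longlonglongrightarrow> 0\<close>, so that \<open>w i + \<sigma> e\<close> becomes independent of \<open>w i\<close> in total variation.
\<close>

section \<open>Second moments of conditional expectations\<close>

lemma sets_vimage_algebra_compose:
  assumes "X \<in> \<Omega> \<rightarrow> space S" "f \<in> measurable S S'"
  shows "sets (vimage_algebra \<Omega> (\<lambda>\<omega>. f (X \<omega>)) S') \<subseteq> sets (vimage_algebra \<Omega> X S)"
  using assms by (intro sets_image_in_sets measurable_compose[OF measurable_vimage_algebra1]) auto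

text \<open>Doob-Dynkin factorization. Each level set of a simple function is a preimage of a
  measurable set, which gives its factor explicitly; a general \<open>Z\<close> is a pointwise limit
  of simple functions.\<close>

lemma vimage_algebra_factor:
  fixes Z :: "'a \<Rightarrow> real"
  assumes X: "X \<in> \<Omega> \<rightarrow> space N" and Z: "Z \<in> borel_measurable (vimage_algebra \<Omega> X N)"
  obtains k where "k \<in> borel_measurable N" "\<And>\<omega>. \<omega> \<in> \<Omega> \<Longrightarrow> Z \<omega> = k (X \<omega>)"
proof -
  let ?F = "vimage_algebra \<Omega> X N"
  obtain s where s: "\<And>i. simple_function ?F (s i)"
    and lim: "\<And>x. x \<in> space ?F \<Longrightarrow> (\<lambda>i. s i x) \<longlonglongrightarrow> Z x"
    using borel_measurable_implies_sequence_metric[OF Z, of 0] by blast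
  have "\<exists>k\<in>borel_measurable N. \<forall>\<omega>\<in>\<Omega>. s i \<omega> = k (X \<omega>)" for i
  proof -
    have fin: "finite (s i ` \<Omega>)"
      using simple_functionD(1)[OF s[of i]] by simp
    have "\<exists>B\<in>sets N. s i -` {y} \<inter> \<Omega> = X -` B \<inter> \<Omega>" for y
      using simple_functionD(2)[OF s[of i], of "{y}"] sets_vimage_algebra2[OF X] by auto
    then obtain B where B: "\<And>y. B y \<in> sets N" "\<And>y. s i -` {y} \<inter> \<Omega> = X -` B y \<inter> \<Omega>"
      by metis
    define k where "k = (\<lambda>x. \<Sum>y\<in>s i ` \<Omega>. y * indicator (B y) x :: real)"
    have "k \<in> borel_measurable N"
      using B(1) unfolding k_def by measurable
    moreover have "s i \<omega> = k (X \<omega>)" if \<omega>: "\<omega> \<in> \<Omega>" for \<omega>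
    proof -
      \<comment> \<open>The sets \<open>B y\<close> may overlap outside the range of
        \<open>X\<close>, but a point \<open>X \<omega>\<close> lies in \<open>B y\<close> only for
        \<open>y = s i \<omega>\<close>.\<close>
      have "y * indicator (B y) (X \<omega>) = (if y = s i \<omega> then y else 0 :: real)" for y
        using B(2)[of y] \<omega> by (auto simp: indicator_def)
      then have "k (X \<omega>) = (\<Sum>y\<in>s i ` \<Omega>. if y = s i \<omega> then y else 0)"
        unfolding k_def by (intro sum.cong refl)
      then show ?thesis
        using fin \<omega> by simp
    qed
    ultimately show ?thesis by blast
  qed
  then obtain k where k: "\<And>i. k i \<in> borel_measurable N" "\<And>i \<omega>. \<omega> \<in> \<Omega> \<Longrightarrow> s i \<omega> = k i (X \<omega>)"
    by metis
  show ?thesis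
  proof (rule that)
    \<comment> \<open>Convergence of the factors is known only on the range of \<open>X\<close>;
      measurability of \<open>lim\<close> covers the other points too, whatever value it takes
      there.\<close>
    show "(\<lambda>x. lim (\<lambda>i. k i x)) \<in> borel_measurable N"
      using k(1) by measurable
    show "Z \<omega> = lim (\<lambda>i. k i (X \<omega>))" if "\<omega> \<in> \<Omega>" for \<omega>
      using lim[of \<omega>] that k(2)[OF that] by (simp add: limI)
  qed
qed

lemma square_integrable_mult:
  fixes f g :: "'a \<Rightarrow> real"
  assumes [measurable]: "f \<in> borel_measurable M" "g \<in> borel_measurable M"
    and f2: "integrable M (\<lambda>x. (f x)\<^sup>2)" and g2: "integrable M (\<lambda>x. (g x)\<^sup>2)"
  shows "integrable M (\<lambda>x. f x * g x)"
proof (rule Bochner_Integration.integrable_bound)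
  show "integrable M (\<lambda>x. (f x)\<^sup>2 + (g x)\<^sup>2)"
    using f2 g2 by simp
  have "\<bar>a * b\<bar> \<le> a\<^sup>2 + b\<^sup>2" for a b :: real
  proof -
    have "2 * (\<bar>a\<bar> * \<bar>b\<bar>) \<le> a\<^sup>2 + b\<^sup>2"
      using sum_squares_bound[of "\<bar>a\<bar>" "\<bar>b\<bar>"] by simp
    moreover have "0 \<le> \<bar>a\<bar> * \<bar>b\<bar>"
      by simp
    ultimately show ?thesis
      unfolding abs_mult by linarith
  qed
  then show "AE x in M. norm (f x * g x) \<le> norm ((f x)\<^sup>2 + (g x)\<^sup>2)"
    by (simp add: abs_of_nonneg)
qed measurable

lemma square_integrable_add:
  fixes f g :: "'a \<Rightarrow> real"
  assumes [measurable]: "f \<in> borel_measurable M" "g \<in> borel_measurable M"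
    and f2: "integrable M (\<lambda>x. (f x)\<^sup>2)" and g2: "integrable M (\<lambda>x. (g x)\<^sup>2)"
  shows "integrable M (\<lambda>x. (f x + g x)\<^sup>2)"
  using f2 g2 square_integrable_mult[OF assms]
  by (simp add: power2_sum mult.assoc)

lemma square_integrable_sum:
  fixes f :: "'i \<Rightarrow> 'a \<Rightarrow> real"
  assumes "finite J" "\<And>j. j \<in> J \<Longrightarrow> f j \<in> borel_measurable M"
    and "\<And>j. j \<in> J \<Longrightarrow> integrable M (\<lambda>x. (f j x)\<^sup>2)"
  shows "integrable M (\<lambda>x. (\<Sum>j\<in>J. f j x)\<^sup>2)"
  using assms
proof (induction J)
  case (insert j J)
  then show ?case
    by (simp add: square_integrable_add)
qed simp

text \<open>This is \<open>V\<close> of the overview. For square integrable \<open>v\<close> its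
  excess over the squared mean is the variance of the posterior mean.\<close>

definition moment2_cond_exp :: "'a measure \<Rightarrow> ('a \<Rightarrow> real) \<Rightarrow> 'a measure \<Rightarrow> real" where
  "moment2_cond_exp M v F = (\<integral>\<omega>. (real_cond_exp M F v \<omega>)\<^sup>2 \<partial>M)"

context prob_space
begin

lemma sigma_finite_subalgebra:
  assumes "subalgebra M F"
  shows "sigma_finite_subalgebra M F"
proof -
  interpret finite_measure_subalgebra M F
    using assms by unfold_locales
  show ?thesis
    by (rule sigma_finite_subalgebra_axioms)
qed

lemma subalgebra_vimage:
  assumes "X \<in> measurable M N"
  shows "subalgebra M (vimage_algebra (space M) X N)"
  using sets_image_in_sets[OF refl assms] by (simp add: subalgebra_def)

section \<open>Conditional expectation as an orthogonal projection\<close>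

context
  fixes v :: "'a \<Rightarrow> real"
  assumes v[measurable]: "random_variable borel v" and v2: "integrable M (\<lambda>\<omega>. (v \<omega>)\<^sup>2)"
begin

text \<open>Conditional Jensen inequality for the square.\<close>

lemma square_integrable_cond_exp:
  assumes "subalgebra M F"
  shows "integrable M (\<lambda>\<omega>. (real_cond_exp M F v \<omega>)\<^sup>2)"
proof -
  interpret sigma_finite_subalgebra M F
    using assms by (rule sigma_finite_subalgebra)
  show ?thesis
    by (rule integrable_convex_cond_exp[where I = UNIV and q = "\<lambda>x. x\<^sup>2"])
      (use v2 square_integrable_imp_integrable[OF v v2] convex_power2 in \<open>auto simp: emeasure_space_1\<close>)
qed

text \<open>Orthogonality of the projection: an \<open>F\<close>-measurable factor can be moved
  inside the conditional expectation.\<close>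

lemma expectation_mult_cond_exp:
  assumes F: "subalgebra M F" and Z: "Z \<in> borel_measurable F" and Z2: "integrable M (\<lambda>\<omega>. (Z \<omega>)\<^sup>2)"
  shows "expectation (\<lambda>\<omega>. Z \<omega> * real_cond_exp M F v \<omega>) = expectation (\<lambda>\<omega>. v \<omega> * Z \<omega>)"
proof -
  interpret sigma_finite_subalgebra M F
    using F by (rule sigma_finite_subalgebra)
  have "Z \<in> borel_measurable M"
    using Z measurable_from_subalg[OF F] by blast
  then have "integrable M (\<lambda>\<omega>. Z \<omega> * v \<omega>)"
    using Z2 v2 v by (intro square_integrable_mult)
  from real_cond_exp_intg(2)[OF this Z v] show ?thesis
    by (simp add: mult.commute)
qed

lemma moment2_cond_exp_eq:
  assumes "subalgebra M F"
  shows "moment2_cond_exp M v F = expectation (\<lambda>\<omega>. v \<omega> * real_cond_exp M F v \<omega>)"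
  using expectation_mult_cond_exp[OF assms borel_measurable_cond_exp square_integrable_cond_exp[OF assms]]
  by (simp add: moment2_cond_exp_def power2_eq_square)

text \<open>Expand the nonnegative mean square distance between \<open>Z\<close> and the conditional
  expectation. Every estimator \<open>Z\<close> thus certifies a lower bound, and all lower bounds
  and comparisons of information below arise from a choice of \<open>Z\<close>.\<close>

lemma moment2_cond_exp_variational:
  assumes F: "subalgebra M F" and Z: "Z \<in> borel_measurable F" and Z2: "integrable M (\<lambda>\<omega>. (Z \<omega>)\<^sup>2)"
  shows "2 * expectation (\<lambda>\<omega>. v \<omega> * Z \<omega>) - expectation (\<lambda>\<omega>. (Z \<omega>)\<^sup>2) \<le> moment2_cond_exp M v F"
proof -
  have Zm[measurable]: "Z \<in> borel_measurable M"
    using Z measurable_from_subalg[OF F] by blast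
  note ce = square_integrable_cond_exp[OF F]
  have "0 \<le> expectation (\<lambda>\<omega>. (real_cond_exp M F v \<omega> - Z \<omega>)\<^sup>2)"
    by simp
  also have "\<dots> = expectation (\<lambda>\<omega>. (real_cond_exp M F v \<omega>)\<^sup>2 + (Z \<omega>)\<^sup>2 - 2 * (Z \<omega> * real_cond_exp M F v \<omega>))"
    by (simp add: power2_diff algebra_simps)
  also have "\<dots> = moment2_cond_exp M v F + expectation (\<lambda>\<omega>. (Z \<omega>)\<^sup>2)
      - 2 * expectation (\<lambda>\<omega>. Z \<omega> * real_cond_exp M F v \<omega>)"
    using Z2 ce square_integrable_mult[OF Zm _ Z2 ce] by (simp add: moment2_cond_exp_def)
  finally show ?thesis
    using expectation_mult_cond_exp[OF assms] by simp
qed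

text \<open>The conditional expectation given the coarser \<open>F\<close> is an admissible
  estimator for \<open>G\<close>, and it attains the second moment for \<open>F\<close>.\<close>

lemma moment2_cond_exp_mono:
  assumes F: "subalgebra M F" and G: "subalgebra M G" and sub: "sets F \<subseteq> sets G"
  shows "moment2_cond_exp M v F \<le> moment2_cond_exp M v G"
proof -
  have "real_cond_exp M F v \<in> borel_measurable G"
    using F G sub borel_measurable_cond_exp[of M F v] unfolding subalgebra_def measurable_def by auto
  from moment2_cond_exp_variational[OF G this square_integrable_cond_exp[OF F]]
  show ?thesis
    using moment2_cond_exp_eq[OF F] by (simp add: moment2_cond_exp_def)
qed

text \<open>A projection is a contraction: expand the mean square of
  \<open>E[v | F] - v\<close>.\<close>

lemma moment2_cond_exp_le:
  assumes F: "subalgebra M F"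
  shows "moment2_cond_exp M v F \<le> expectation (\<lambda>\<omega>. (v \<omega>)\<^sup>2)"
proof -
  note ce = square_integrable_cond_exp[OF F]
  have "0 \<le> expectation (\<lambda>\<omega>. (real_cond_exp M F v \<omega> - v \<omega>)\<^sup>2)"
    by simp
  also have "\<dots> = expectation (\<lambda>\<omega>. (real_cond_exp M F v \<omega>)\<^sup>2 + (v \<omega>)\<^sup>2 - 2 * (v \<omega> * real_cond_exp M F v \<omega>))"
    by (simp add: power2_diff algebra_simps)
  also have "\<dots> = moment2_cond_exp M v F + expectation (\<lambda>\<omega>. (v \<omega>)\<^sup>2)
      - 2 * expectation (\<lambda>\<omega>. v \<omega> * real_cond_exp M F v \<omega>)"
    using v2 ce square_integrable_mult[OF v _ v2 ce] by (simp add: moment2_cond_exp_def)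
  finally show ?thesis
    using moment2_cond_exp_eq[OF F] by simp
qed

lemma expectation_cond_exp:
  assumes F: "subalgebra M F"
  shows "integrable M (real_cond_exp M F v)" "expectation (real_cond_exp M F v) = expectation v"
proof -
  interpret sigma_finite_subalgebra M F
    using F by (rule sigma_finite_subalgebra)
  show "integrable M (real_cond_exp M F v)" "expectation (real_cond_exp M F v) = expectation v"
    using square_integrable_imp_integrable[OF v v2] by (auto intro: real_cond_exp_int)
qed

text \<open>This evaluates the cross term of price and demand in the producer surplus. The coarser
  conditional expectation is measurable for the finer information, so it may be paired with
  \<open>v\<close> itself.\<close>

lemma expectation_cond_exp_nested:
  assumes "subalgebra M I" "subalgebra M Y" "sets Y \<subseteq> sets I"
  shows "expectation (\<lambda>\<omega>. real_cond_exp M Y v \<omega> * real_cond_exp M I v \<omega>) = moment2_cond_exp M v Y"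
proof -
  have "real_cond_exp M Y v \<in> borel_measurable I"
    using assms borel_measurable_cond_exp[of M Y v] unfolding subalgebra_def measurable_def by auto
  from expectation_mult_cond_exp[OF assms(1) this square_integrable_cond_exp[OF assms(2)]]
  show ?thesis
    by (simp add: moment2_cond_exp_eq[OF assms(2)])
qed

text \<open>The markup is measurable for the producer's information, so only the conditional mean of
  demand given \<open>Y\<close> counts, and \<open>I\<close> drops out.\<close>

lemma producer_surplus_eq:
  assumes I: "subalgebra M I" and Y: "subalgebra M Y" and sub: "sets Y \<subseteq> sets I"
  shows "producer_surplus M c v I Y = (moment2_cond_exp M v Y - 2 * c * expectation v + c\<^sup>2) / 4"
proof -
  let ?a = "real_cond_exp M Y v" and ?b = "real_cond_exp M I v"
  have ab: "integrable M (\<lambda>\<omega>. ?a \<omega> * ?b \<omega>)"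
    by (intro square_integrable_mult square_integrable_cond_exp I Y) auto
  have "producer_surplus M c v I Y
    = expectation (\<lambda>\<omega>. (?a \<omega> * ?b \<omega>) / 2 - (?a \<omega>)\<^sup>2 / 4 - c * ?b \<omega> / 2 + c\<^sup>2 / 4)"
  proof -
    have "((x + c) / 2 - c) * (y - (x + c) / 2) = (x * y) / 2 - x\<^sup>2 / 4 - c * y / 2 + c\<^sup>2 / 4" for x y :: real
      by (simp add: field_simps power2_eq_square)
    then show ?thesis
      by (simp only: producer_surplus_def demand_def price_def)
  qed
  also have "\<dots> = (moment2_cond_exp M v Y - 2 * c * expectation v + c\<^sup>2) / 4"
    using ab square_integrable_cond_exp[OF Y] expectation_cond_exp[OF I]
      expectation_cond_exp_nested[OF assms]
    by (simp add: moment2_cond_exp_def prob_space)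
  finally show ?thesis .
qed

text \<open>The products mixing the two conditional expectations cancel, and \<open>v\<close> paired
  with a conditional expectation gives its second moment. The consumer gains from own information
  with weight 1/2 and loses from the producer's with weight 3/8.\<close>

lemma consumer_surplus_eq:
  assumes I: "subalgebra M I" and Y: "subalgebra M Y" and sub: "sets Y \<subseteq> sets I"
  shows "consumer_surplus M c v I Y =
    moment2_cond_exp M v I / 2 - 3 / 8 * moment2_cond_exp M v Y - c * expectation v / 4 + c\<^sup>2 / 8"
proof -
  let ?a = "real_cond_exp M Y v" and ?b = "real_cond_exp M I v"
  have a_I: "?a \<in> borel_measurable I"
    using assms borel_measurable_cond_exp[of M Y v] unfolding subalgebra_def measurable_def by auto
  note a2 = square_integrable_cond_exp[OF Y] and b2 = square_integrable_cond_exp[OF I]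
  have ab: "integrable M (\<lambda>\<omega>. ?a \<omega> * ?b \<omega>)" and va: "integrable M (\<lambda>\<omega>. v \<omega> * ?a \<omega>)"
    and vb: "integrable M (\<lambda>\<omega>. v \<omega> * ?b \<omega>)"
    by (intro square_integrable_mult a2 b2 v v2; simp)+
  have va_eq: "expectation (\<lambda>\<omega>. v \<omega> * ?a \<omega>) = moment2_cond_exp M v Y"
    using moment2_cond_exp_eq[OF Y] by simp
  have vb_eq: "expectation (\<lambda>\<omega>. v \<omega> * ?b \<omega>) = moment2_cond_exp M v I"
    using moment2_cond_exp_eq[OF I] by simp
  have "consumer_surplus M c v I Y
    = expectation (\<lambda>\<omega>. v \<omega> * ?b \<omega> - v \<omega> * ?a \<omega> / 2 - c * v \<omega> / 2 - (?b \<omega>)\<^sup>2 / 2 + (?a \<omega>)\<^sup>2 / 8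
       + c * ?a \<omega> / 4 + c\<^sup>2 / 8)"
  proof -
    have "z * (y - (x + c) / 2) - (x + c) / 2 * (y - (x + c) / 2) - (y - (x + c) / 2)\<^sup>2 / 2
        = z * y - z * x / 2 - c * z / 2 - y\<^sup>2 / 2 + x\<^sup>2 / 8 + c * x / 4 + c\<^sup>2 / 8" for x y z :: real
      by (simp add: field_simps power2_eq_square)
    then show ?thesis
      by (simp only: consumer_surplus_def demand_def price_def)
  qed
  also have "\<dots> = moment2_cond_exp M v I / 2 - 3 / 8 * moment2_cond_exp M v Y - c * expectation v / 4 + c\<^sup>2 / 8"
    using ab va vb a2 b2 expectation_cond_exp[OF I] expectation_cond_exp[OF Y] va_eq vb_eq
      square_integrable_imp_integrable[OF v v2]
    by (simp add: moment2_cond_exp_def prob_space)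
  finally show ?thesis .
qed

end

text \<open>The trivial sigma-algebra consists of the empty set and the whole space, and over both
  of them the constant \<open>expectation v\<close> has the same integral as
  \<open>v\<close>.\<close>

lemma moment2_no_info:
  assumes v: "integrable M (v :: 'a \<Rightarrow> real)"
  shows "subalgebra M (no_info M)" "moment2_cond_exp M v (no_info M) = (expectation v)\<^sup>2"
proof -
  have sets: "sets (no_info M) = {{}, space M}" and [simp]: "space (no_info M) = space M"
    by (auto simp: no_info_def sigma_sets_empty_eq)
  show F: "subalgebra M (no_info M)"
    by (auto simp: subalgebra_def sets)
  interpret sigma_finite_subalgebra M "no_info M"
    using F by (rule sigma_finite_subalgebra)
  have "AE \<omega> in M. real_cond_exp M (no_info M) v \<omega> = expectation v"
  proof (rule real_cond_exp_charact)
    show "(LINT \<omega>:A|M. v \<omega>) = (LINT \<omega>:A|M. expectation v)" if "A \<in> sets (no_info M)" for A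
      using that v by (auto simp: sets set_lebesgue_integral_def prob_space cong: Bochner_Integration.integral_cong)
  qed (use v in auto)
  then have "expectation (\<lambda>\<omega>. (real_cond_exp M (no_info M) v \<omega>)\<^sup>2) = expectation (\<lambda>_. (expectation v)\<^sup>2)"
    by (intro integral_cong_AE) auto
  then show "moment2_cond_exp M v (no_info M) = (expectation v)\<^sup>2"
    by (simp add: moment2_cond_exp_def prob_space)
qed

end

section \<open>Randomized and independent information\<close>

context prob_space
begin

lemma indep_set_vimage_compose:
  assumes ind: "indep_set (sets (vimage_algebra (space M) X S)) (sets (vimage_algebra (space M) Y T))"
    and rv: "random_variable S X" "random_variable T Y"
    and f: "f \<in> measurable S S'" and g: "g \<in> measurable T T'"
  shows "indep_set (sets (vimage_algebra (space M) (\<lambda>\<omega>. f (X \<omega>)) S'))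
    (sets (vimage_algebra (space M) (\<lambda>\<omega>. g (Y \<omega>)) T'))"
  using ind sets_vimage_algebra_compose[OF _ f, of X "space M"] sets_vimage_algebra_compose[OF _ g, of Y "space M"]
    measurable_space[OF rv(1)] measurable_space[OF rv(2)]
  unfolding indep_sets2_eq by blast

text \<open>The product measure is determined on rectangles, where independence is the product
  formula. Independence is phrased by generated sigma-algebras because the two variables may take
  values in different types.\<close>

lemma indep_set_vimage_distr:
  assumes ind: "indep_set (sets (vimage_algebra (space M) X S)) (sets (vimage_algebra (space M) Y T))"
    and rv[measurable]: "random_variable S X" "random_variable T Y"
  shows "distr M S X \<Otimes>\<^sub>M distr M T Y = distr M (S \<Otimes>\<^sub>M T) (\<lambda>\<omega>. (X \<omega>, Y \<omega>))"
proof (rule pair_measure_eqI)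
  interpret X: prob_space "distr M S X"
    by (rule prob_space_distr) measurable
  interpret Y: prob_space "distr M T Y"
    by (rule prob_space_distr) measurable
  show "sigma_finite_measure (distr M S X)" "sigma_finite_measure (distr M T Y)"
    by unfold_locales
  show "sets (distr M S X \<Otimes>\<^sub>M distr M T Y) = sets (distr M (S \<Otimes>\<^sub>M T) (\<lambda>\<omega>. (X \<omega>, Y \<omega>)))"
    by simp
  fix A B assume "A \<in> sets (distr M S X)" "B \<in> sets (distr M T Y)"
  then have [measurable]: "A \<in> sets S" "B \<in> sets T"
    by auto
  have "(\<lambda>\<omega>. (X \<omega>, Y \<omega>)) -` (A \<times> B) \<inter> space M = (X -` A \<inter> space M) \<inter> (Y -` B \<inter> space M)"
    by auto
  moreover have "prob ((X -` A \<inter> space M) \<inter> (Y -` B \<inter> space M)) = prob (X -` A \<inter> space M) * prob (Y -` B \<inter> space M)"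
    by (intro indep_setD[OF ind] in_vimage_algebra) measurable
  ultimately show "emeasure (distr M S X) A * emeasure (distr M T Y) B
      = emeasure (distr M (S \<Otimes>\<^sub>M T) (\<lambda>\<omega>. (X \<omega>, Y \<omega>))) (A \<times> B)"
    by (simp add: emeasure_distr emeasure_eq_measure ennreal_mult)
qed

context
  fixes T :: "'t set" and \<rho> :: "'a \<Rightarrow> 't" and U :: "'a \<Rightarrow> 'u" and NU :: "'u measure"
  assumes T: "finite T" "T \<noteq> {}"
    and rv[measurable]: "random_variable (count_space T) \<rho>" "random_variable NU U"
    and ind: "indep_set (sets (vimage_algebra (space M) \<rho> (count_space T)))
      (sets (vimage_algebra (space M) U NU))"
    and uniform: "distr M (count_space T) \<rho> = uniform_count_measure T"
begin

text \<open>Fubini for the joint law of \<open>\<rho>\<close> and \<open>U\<close>, which is a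
  product; the outer integral is a finite average. Finiteness of \<open>T\<close> reduces joint
  measurability to measurability of each \<open>f t\<close>.\<close>

lemma uniform_mixture:
  fixes f :: "'t \<Rightarrow> 'u \<Rightarrow> real"
  assumes f: "\<And>t. t \<in> T \<Longrightarrow> f t \<in> borel_measurable NU"
    and int: "integrable M (\<lambda>\<omega>. f (\<rho> \<omega>) (U \<omega>))"
  shows "\<And>t. t \<in> T \<Longrightarrow> integrable M (\<lambda>\<omega>. f t (U \<omega>))"
    and "expectation (\<lambda>\<omega>. f (\<rho> \<omega>) (U \<omega>)) = (\<Sum>t\<in>T. expectation (\<lambda>\<omega>. f t (U \<omega>))) / card T"
proof -
  interpret D: prob_space "distr M NU U"
    by (rule prob_space_distr) measurable
  interpret R: prob_space "uniform_count_measure T"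
    using T by (rule prob_space_uniform_count_measure)
  interpret P: pair_prob_space "uniform_count_measure T" "distr M NU U" ..
  let ?F = "\<lambda>(t, u). f t u"
  have meas: "?F \<in> borel_measurable (count_space T \<Otimes>\<^sub>M NU)"
    using T f by (intro measurable_pair_measure_countable1) (auto intro: countable_finite)
  have joint: "uniform_count_measure T \<Otimes>\<^sub>M distr M NU U = distr M (count_space T \<Otimes>\<^sub>M NU) (\<lambda>\<omega>. (\<rho> \<omega>, U \<omega>))"
    using indep_set_vimage_distr[OF ind rv] uniform by simp
  have int': "integrable (uniform_count_measure T \<Otimes>\<^sub>M distr M NU U) ?F"
    unfolding joint using int meas by (subst integrable_distr_eq) auto
  have "AE t in uniform_count_measure T. integrable (distr M NU U) (f t)"
    using P.AE_integrable_fst'[OF int'] by simp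
  \<comment> \<open>Every point of \<open>T\<close> has positive mass, so a property that holds
    almost everywhere holds at every point.\<close>
  then have "integrable (distr M NU U) (f t)" if "t \<in> T" for t
    using that T unfolding uniform_count_measure_def AE_point_measure by (auto simp: ennreal_zero_less_divide)
  then show "\<And>t. t \<in> T \<Longrightarrow> integrable M (\<lambda>\<omega>. f t (U \<omega>))"
    using f by (simp add: integrable_distr_eq)
  have "expectation (\<lambda>\<omega>. f (\<rho> \<omega>) (U \<omega>)) = integral\<^sup>L (uniform_count_measure T \<Otimes>\<^sub>M distr M NU U) ?F"
    unfolding joint using meas by (subst integral_distr) auto
  also have "\<dots> = (\<Sum>t\<in>T. integral\<^sup>L (distr M NU U) (f t)) / card T"
    using P.integral_fst'[OF int'] T by (simp add: integral_uniform_count_measure)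
  also have "\<dots> = (\<Sum>t\<in>T. expectation (\<lambda>\<omega>. f t (U \<omega>))) / card T"
    using f by (simp add: integral_distr)
  finally show "expectation (\<lambda>\<omega>. f (\<rho> \<omega>) (U \<omega>)) = (\<Sum>t\<in>T. expectation (\<lambda>\<omega>. f t (U \<omega>))) / card T" .
qed

text \<open>
  An estimator that depends on the independent randomization \<open>\<rho>\<close> is improved by averaging over \<open>\<rho>\<close>.
\<close>

lemma moment2_cond_exp_derandomize:
  fixes h :: "'u \<Rightarrow> real" and k :: "'t \<Rightarrow> 'u \<Rightarrow> real"
  assumes h: "h \<in> borel_measurable NU" "integrable M (\<lambda>\<omega>. (h (U \<omega>))\<^sup>2)"
    and G: "subalgebra M G" and G': "subalgebra M G'"
    and k: "\<And>t. t \<in> T \<Longrightarrow> k t \<in> borel_measurable NU"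
      "\<And>\<omega>. \<omega> \<in> space M \<Longrightarrow> real_cond_exp M G (\<lambda>\<omega>. h (U \<omega>)) \<omega> = k (\<rho> \<omega>) (U \<omega>)"
    and avg: "(\<lambda>\<omega>. (\<Sum>t\<in>T. k t (U \<omega>)) / card T) \<in> borel_measurable G'"
  shows "moment2_cond_exp M (\<lambda>\<omega>. h (U \<omega>)) G \<le> moment2_cond_exp M (\<lambda>\<omega>. h (U \<omega>)) G'"
proof -
  let ?v = "\<lambda>\<omega>. h (U \<omega>)" and ?\<phi> = "\<lambda>\<omega>. (\<Sum>t\<in>T. k t (U \<omega>)) / card T"
  have v: "random_variable borel ?v"
    using h(1) by measurable
  have kU[measurable]: "random_variable borel (\<lambda>\<omega>. k t (U \<omega>))" if "t \<in> T" for t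
    using k(1)[OF that] by measurable
  note Z2 = square_integrable_cond_exp[OF v h(2) G]
  have "integrable M (\<lambda>\<omega>. ?v \<omega> * real_cond_exp M G ?v \<omega>)"
    by (intro square_integrable_mult v h(2) Z2) simp
  then have vZ: "integrable M (\<lambda>\<omega>. h (U \<omega>) * k (\<rho> \<omega>) (U \<omega>))"
    using k(2) by (simp cong: Bochner_Integration.integrable_cong)
  have kk: "integrable M (\<lambda>\<omega>. (k (\<rho> \<omega>) (U \<omega>))\<^sup>2)"
    using Z2 k(2) by (simp cong: Bochner_Integration.integrable_cong)
  have mix1: "\<And>t. t \<in> T \<Longrightarrow> integrable M (\<lambda>\<omega>. h (U \<omega>) * k t (U \<omega>))"
    "expectation (\<lambda>\<omega>. h (U \<omega>) * k (\<rho> \<omega>) (U \<omega>)) = (\<Sum>t\<in>T. expectation (\<lambda>\<omega>. h (U \<omega>) * k t (U \<omega>))) / card T"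
    using uniform_mixture[of "\<lambda>t u. h u * k t u"] vZ h(1) k(1) by auto
  have mix2: "\<And>t. t \<in> T \<Longrightarrow> integrable M (\<lambda>\<omega>. (k t (U \<omega>))\<^sup>2)"
    "expectation (\<lambda>\<omega>. (k (\<rho> \<omega>) (U \<omega>))\<^sup>2) = (\<Sum>t\<in>T. expectation (\<lambda>\<omega>. (k t (U \<omega>))\<^sup>2)) / card T"
    using uniform_mixture[of "\<lambda>t u. (k t u)\<^sup>2"] kk k(1) by auto
  have n: "card T > 0"
    using T by (simp add: card_gt_0_iff)
  have \<phi>2: "integrable M (\<lambda>\<omega>. (?\<phi> \<omega>)\<^sup>2)"
    using square_integrable_sum[OF T(1) kU mix2(1)] by (simp add: power_divide)
  have "moment2_cond_exp M ?v G = expectation (\<lambda>\<omega>. ?v \<omega> * real_cond_exp M G ?v \<omega>)"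
    by (rule moment2_cond_exp_eq[OF v h(2) G])
  also have "\<dots> = expectation (\<lambda>\<omega>. h (U \<omega>) * k (\<rho> \<omega>) (U \<omega>))"
    using k(2) by (simp cong: Bochner_Integration.integral_cong)
  \<comment> \<open>Averaging over \<open>\<rho>\<close> leaves the pairing with \<open>?v\<close>
    unchanged, since \<open>?v\<close> is a function of \<open>U\<close> alone.\<close>
  also have "\<dots> = expectation (\<lambda>\<omega>. ?v \<omega> * ?\<phi> \<omega>)"
    unfolding mix1(2) using mix1(1) by (simp add: sum_distrib_left)
  finally have eq: "moment2_cond_exp M ?v G = expectation (\<lambda>\<omega>. ?v \<omega> * ?\<phi> \<omega>)" .
  \<comment> \<open>Averaging can only lower the second moment, by convexity of the square. The
    averaged estimator then scores at least twice the old second moment minus once the old second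
    moment.\<close>
  have "expectation (\<lambda>\<omega>. (?\<phi> \<omega>)\<^sup>2) \<le> expectation (\<lambda>\<omega>. (\<Sum>t\<in>T. (k t (U \<omega>))\<^sup>2) / card T)"
  proof (rule integral_mono[OF \<phi>2])
    show "integrable M (\<lambda>\<omega>. (\<Sum>t\<in>T. (k t (U \<omega>))\<^sup>2) / card T)"
      using mix2(1) by simp
    show "(?\<phi> \<omega>)\<^sup>2 \<le> (\<Sum>t\<in>T. (k t (U \<omega>))\<^sup>2) / card T" for \<omega>
      using sum_squared_le_sum_of_squares[of "\<lambda>t. k t (U \<omega>)" T] n
      by (simp add: power_divide power2_eq_square field_simps)
  qed
  also have "\<dots> = expectation (\<lambda>\<omega>. (k (\<rho> \<omega>) (U \<omega>))\<^sup>2)"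
    unfolding mix2(2) using mix2(1) by simp
  also have "\<dots> = moment2_cond_exp M ?v G"
    unfolding moment2_cond_exp_def using k(2) by (simp cong: Bochner_Integration.integral_cong)
  finally show ?thesis
    using moment2_cond_exp_variational[OF v h(2) G' avg \<phi>2] eq by simp
qed

end

text \<open>Write the conditional expectation as \<open>k (Y \<omega>)\<close>. Its pairing with
  \<open>v\<close> factors by independence, and \<open>k (Y \<omega>)\<close> has the same mean as
  \<open>v\<close>.\<close>

lemma moment2_cond_exp_indep:
  assumes v: "random_variable borel v" and Y: "random_variable S Y"
    and ind: "indep_set (sets (vimage_algebra (space M) v borel)) (sets (vimage_algebra (space M) Y S))"
    and v2: "integrable M (\<lambda>\<omega>. (v \<omega>)\<^sup>2)"
  shows "moment2_cond_exp M v (vimage_algebra (space M) Y S) = (expectation v)\<^sup>2"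
proof -
  let ?G = "vimage_algebra (space M) Y S"
  have G: "subalgebra M ?G"
    using Y by (rule subalgebra_vimage)
  obtain k where k: "k \<in> borel_measurable S" "\<And>\<omega>. \<omega> \<in> space M \<Longrightarrow> real_cond_exp M ?G v \<omega> = k (Y \<omega>)"
    using vimage_algebra_factor[of Y "space M" S "real_cond_exp M ?G v"] measurable_space[OF Y] by auto
  have ind_k: "indep_var borel v borel (\<lambda>\<omega>. k (Y \<omega>))"
    using indep_set_vimage_compose[OF ind v Y measurable_ident k(1)] v Y k(1)
    by (simp add: indep_var_eq sets_vimage_algebra measurable_compose)
  note ce = expectation_cond_exp[OF v v2 G]
  have k_int: "integrable M (\<lambda>\<omega>. k (Y \<omega>))" and k_exp: "expectation (\<lambda>\<omega>. k (Y \<omega>)) = expectation v"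
    using ce k(2) by (simp_all cong: Bochner_Integration.integrable_cong Bochner_Integration.integral_cong)
  have "moment2_cond_exp M v ?G = expectation (\<lambda>\<omega>. v \<omega> * k (Y \<omega>))"
    unfolding moment2_cond_exp_eq[OF v v2 G] using k(2) by (simp cong: Bochner_Integration.integral_cong)
  also have "\<dots> = expectation v * expectation (\<lambda>\<omega>. k (Y \<omega>))"
    using square_integrable_imp_integrable[OF v v2] k_int ind_k by (intro indep_var_lebesgue_integral)
  finally show ?thesis
    by (simp add: k_exp power2_eq_square)
qed

end

section \<open>Continuity of translation in L1\<close>

lemma lborel_integral_translate:
  fixes f :: "real \<Rightarrow> real"
  shows "(\<integral>x. f (x - a) \<partial>lborel) = (\<integral>x. f x \<partial>lborel)"
  using lborel_integral_real_affine[of 1 f "- a"] by simp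

lemma lborel_integrable_translate:
  fixes f :: "real \<Rightarrow> real"
  assumes "integrable lborel f"
  shows "integrable lborel (\<lambda>x. f (x - a))"
  using lborel_integrable_real_affine[OF assms, of 1 "- a"] by simp

text \<open>If \<open>f\<close> is the density of a random variable, this is twice the total
  variation distance between its law and that law shifted by \<open>a\<close>.\<close>

definition L1_translation :: "(real \<Rightarrow> real) \<Rightarrow> real \<Rightarrow> real" where
  "L1_translation f a = (\<integral>x. \<bar>f (x - a) - f x\<bar> \<partial>lborel)"

lemma L1_translation_nonneg: "0 \<le> L1_translation f a"
  unfolding L1_translation_def by simp

text \<open>Triangle inequality through the translate of \<open>g\<close> and through
  \<open>g\<close>. By translation invariance the two error terms are equal, hence the factor
  2.\<close>

lemma L1_translation_le:
  assumes f: "integrable lborel f" and g: "integrable lborel g"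
  shows "L1_translation f a \<le> L1_translation g a + 2 * (\<integral>x. \<bar>f x - g x\<bar> \<partial>lborel)"
proof -
  note [simp] = f g lborel_integrable_translate[OF f] lborel_integrable_translate[OF g]
  have d: "(\<integral>x. \<bar>f (x - a) - g (x - a)\<bar> \<partial>lborel) = (\<integral>x. \<bar>f x - g x\<bar> \<partial>lborel)"
    using lborel_integral_translate[of "\<lambda>x. \<bar>f x - g x\<bar>"] by simp
  have "L1_translation f a
      \<le> (\<integral>x. \<bar>g (x - a) - g x\<bar> + \<bar>f (x - a) - g (x - a)\<bar> + \<bar>f x - g x\<bar> \<partial>lborel)"
    unfolding L1_translation_def by (intro integral_mono) auto
  also have "\<dots> = L1_translation g a + 2 * (\<integral>x. \<bar>f x - g x\<bar> \<partial>lborel)"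
    by (simp add: d L1_translation_def)
  finally show ?thesis .
qed

text \<open>Closure of the convergence under L1 approximation. It is used twice: to pass from open
  to measurable sets, and from simple functions to their limits.\<close>

lemma L1_translation_tendsto_approx:
  assumes f: "integrable lborel f"
    and approx: "\<And>\<epsilon>. 0 < \<epsilon> \<Longrightarrow> \<exists>g. integrable lborel g \<and> (\<integral>x. \<bar>f x - g x\<bar> \<partial>lborel) < \<epsilon> \<and>
      (\<lambda>n. L1_translation g (a n)) \<longlonglongrightarrow> 0"
  shows "(\<lambda>n. L1_translation f (a n)) \<longlonglongrightarrow> 0"
proof (rule LIMSEQ_I)
  fix r :: real assume "0 < r"
  then obtain g where g: "integrable lborel g" "(\<integral>x. \<bar>f x - g x\<bar> \<partial>lborel) < r / 4"
    and lim: "(\<lambda>n. L1_translation g (a n)) \<longlonglongrightarrow> 0"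
    \<comment> \<open>The approximation error counts twice, which leaves \<open>r / 2\<close> for
      the translation of \<open>g\<close>.\<close>
    using approx[of "r / 4"] by auto
  from LIMSEQ_D[OF lim, of "r / 2"] \<open>0 < r\<close>
  obtain n0 where n0: "\<And>n. n \<ge> n0 \<Longrightarrow> \<bar>L1_translation g (a n)\<bar> < r / 2"
    by auto
  have "norm (L1_translation f (a n) - 0) < r" if "n \<ge> n0" for n
    using L1_translation_le[OF f g(1), of "a n"] n0[OF that] g(2) L1_translation_nonneg[of f "a n"]
    by simp
  then show "\<exists>n0. \<forall>n\<ge>n0. norm (L1_translation f (a n) - 0) < r"
    by blast
qed

text \<open>For indicators the absolute difference is the sum minus twice the product, so it
  suffices that the overlap of \<open>U\<close> with its translate tends to the measure of
  \<open>U\<close>. A point of the open set \<open>U\<close> stays in \<open>U\<close> under small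
  shifts, and the factor \<open>?u x\<close> removes all other points; dominated convergence
  applies.\<close>

lemma L1_translation_tendsto_open:
  assumes U: "open U" "emeasure lborel U < \<infinity>" and a: "a \<longlonglongrightarrow> 0"
  shows "(\<lambda>n. L1_translation (indicator U) (a n)) \<longlonglongrightarrow> 0"
proof -
  let ?u = "indicator U :: real \<Rightarrow> real"
  have [measurable]: "U \<in> sets borel"
    using U(1) by simp
  have int[simp]: "integrable lborel ?u"
    using U(2) by (intro integrable_real_indicator) auto
  have int_tr[simp]: "integrable lborel (\<lambda>x. ?u (x - b))" for b
    by (rule lborel_integrable_translate[OF int])
  have int_prod[simp]: "integrable lborel (\<lambda>x. ?u x * ?u (x - b))" for b
    by (rule Bochner_Integration.integrable_bound[OF int]) (auto simp: indicator_def)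
  have eq: "L1_translation ?u b = 2 * (\<integral>x. ?u x \<partial>lborel) - 2 * (\<integral>x. ?u x * ?u (x - b) \<partial>lborel)" for b
  proof -
    have "L1_translation ?u b = (\<integral>x. ?u (x - b) + ?u x - 2 * (?u x * ?u (x - b)) \<partial>lborel)"
      unfolding L1_translation_def
      by (intro Bochner_Integration.integral_cong) (auto simp: indicator_def)
    then show ?thesis
      using lborel_integral_translate[of ?u b] by simp
  qed
  have "(\<lambda>n. \<integral>x. ?u x * ?u (x - a n) \<partial>lborel) \<longlonglongrightarrow> (\<integral>x. ?u x \<partial>lborel)"
  proof (rule integral_dominated_convergence[where w = ?u])
    show "AE x in lborel. (\<lambda>n. ?u x * ?u (x - a n)) \<longlonglongrightarrow> ?u x"
    proof (rule AE_I2, cases)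
      fix x assume "x \<in> U"
      have "(\<lambda>n. x - a n) \<longlonglongrightarrow> x - 0"
        by (intro tendsto_intros a)
      then have "\<forall>\<^sub>F n in sequentially. x - a n \<in> U"
        using topological_tendstoD[OF _ U(1)] \<open>x \<in> U\<close> by fastforce
      then show "(\<lambda>n. ?u x * ?u (x - a n)) \<longlonglongrightarrow> ?u x"
        by (rule tendsto_eventually[OF eventually_mono]) (use \<open>x \<in> U\<close> in auto)
    qed auto
  qed (auto simp: indicator_def)
  then have "(\<lambda>n. 2 * (\<integral>x. ?u x \<partial>lborel) - 2 * (\<integral>x. ?u x * ?u (x - a n) \<partial>lborel))
      \<longlonglongrightarrow> 2 * (\<integral>x. ?u x \<partial>lborel) - 2 * (\<integral>x. ?u x \<partial>lborel)"
    by (intro tendsto_intros)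
  then show ?thesis
    unfolding eq by simp
qed

text \<open>Induction over integrable functions: indicators are approximated by indicators of open
  sets, sums follow from the triangle inequality, and limits from L1 approximation.\<close>

lemma L1_translation_tendsto:
  assumes f: "integrable lborel f" and a: "a \<longlonglongrightarrow> 0"
  shows "(\<lambda>n. L1_translation f (a n)) \<longlonglongrightarrow> 0"
  using f
proof (induction f rule: integrable_induct)
  case (base A c)
  have [measurable]: "A \<in> sets borel"
    using base(1) by simp
  have int_A: "integrable lborel (indicator A :: real \<Rightarrow> real)"
    using base by (intro integrable_real_indicator) auto
  have "(\<lambda>n. L1_translation (indicator A) (a n)) \<longlonglongrightarrow> 0"
  proof (rule L1_translation_tendsto_approx[OF int_A])
    fix \<epsilon> :: real assume "0 < \<epsilon>"
    \<comment> \<open>Outer regularity of Lebesgue measure supplies the open set; it has finite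
      measure because \<open>A\<close> has.\<close>
    obtain U where U: "open U" "A \<subseteq> U" "emeasure lborel (U - A) < ennreal \<epsilon>"
      using outer_regular_lborel[of A \<epsilon>] \<open>0 < \<epsilon>\<close> by auto
    have [measurable]: "U \<in> sets borel"
      using U(1) by simp
    have "emeasure lborel U = emeasure lborel A + emeasure lborel (U - A)"
      using U(2) by (subst plus_emeasure) (auto simp: Un_absorb1)
    then have fin: "emeasure lborel U < \<infinity>"
      using base(2) U(3) by (metis ennreal_add_less_top ennreal_less_top infinity_ennreal_def less_trans)
    have "(\<integral>x. \<bar>indicator A x - indicator U x\<bar> \<partial>lborel) = (\<integral>x. indicator (U - A) x \<partial>lborel :: real)"
      using U(2) by (intro Bochner_Integration.integral_cong) (auto simp: indicator_def)
    also have "\<dots> = measure lborel (U - A)"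
      by simp
    also have "\<dots> < \<epsilon>"
      using U(3) \<open>0 < \<epsilon>\<close> order_less_trans[OF U(3) ennreal_less_top]
      by (simp add: emeasure_eq_ennreal_measure ennreal_less_iff less_top)
    finally show "\<exists>g. integrable lborel g \<and> (\<integral>x. \<bar>indicator A x - g x\<bar> \<partial>lborel) < \<epsilon> \<and>
        (\<lambda>n. L1_translation g (a n)) \<longlonglongrightarrow> 0"
      using L1_translation_tendsto_open[OF U(1) fin a] fin
      by (intro exI[of _ "indicator U"]) auto
  qed
  moreover have "L1_translation (\<lambda>x. indicator A x *\<^sub>R c) b = L1_translation (indicator A) b * \<bar>c\<bar>" for b
    unfolding L1_translation_def
    by (simp add: left_diff_distrib[symmetric] abs_mult)
  ultimately show ?case
    by (simp add: tendsto_mult_left_zero)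
next
  case (add f g)
  note [simp] = add.hyps lborel_integrable_translate[OF add.hyps(1)] lborel_integrable_translate[OF add.hyps(2)]
  show ?case
  proof (rule tendsto_sandwich)
    show "\<forall>\<^sub>F n in sequentially. 0 \<le> L1_translation (\<lambda>x. f x + g x) (a n)"
      by (simp add: L1_translation_nonneg)
    have "L1_translation (\<lambda>x. f x + g x) b \<le> L1_translation f b + L1_translation g b" for b
      unfolding L1_translation_def
      by (subst Bochner_Integration.integral_add[symmetric], simp, simp, intro integral_mono) auto
    then show "\<forall>\<^sub>F n in sequentially.
        L1_translation (\<lambda>x. f x + g x) (a n) \<le> L1_translation f (a n) + L1_translation g (a n)"
      by simp
    show "(\<lambda>n. L1_translation f (a n) + L1_translation g (a n)) \<longlonglongrightarrow> 0"
      using tendsto_add[OF add.IH] by simp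
  qed simp
next
  case (lim f s)
  have [measurable]: "f \<in> borel_measurable borel" "\<And>i. s i \<in> borel_measurable borel"
    using lim.hyps by auto
  have "(\<lambda>i. \<integral>x. \<bar>f x - s i x\<bar> \<partial>lborel) \<longlonglongrightarrow> (\<integral>x. 0 \<partial>(lborel :: real measure))"
  \<comment> \<open>The induction rule provides approximants bounded by twice
    \<open>\<bar>f x\<bar>\<close>; one more \<open>\<bar>f x\<bar>\<close> comes from
    \<open>f\<close> itself.\<close>
  proof (rule integral_dominated_convergence[where w = "\<lambda>x. 3 * \<bar>f x\<bar>"])
    have "(\<lambda>i. \<bar>f x - s i x\<bar>) \<longlonglongrightarrow> \<bar>f x - f x\<bar>" for x
      by (intro tendsto_intros lim.hyps(2)) simp
    then show "AE x in lborel. (\<lambda>i. \<bar>f x - s i x\<bar>) \<longlonglongrightarrow> 0"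
      by simp
    show "AE x in lborel. norm \<bar>f x - s i x\<bar> \<le> 3 * \<bar>f x\<bar>" for i
    proof (rule AE_I2)
      fix x :: real
      show "norm \<bar>f x - s i x\<bar> \<le> 3 * \<bar>f x\<bar>"
        using lim.hyps(3)[of x i] by simp
    qed
  qed (use lim.hyps(4) in auto)
  then have conv: "(\<lambda>i. \<integral>x. \<bar>f x - s i x\<bar> \<partial>lborel) \<longlonglongrightarrow> 0"
    by simp
  show ?case
  proof (rule L1_translation_tendsto_approx[OF lim.hyps(4)])
    fix \<epsilon> :: real assume "0 < \<epsilon>"
    then obtain i where "(\<integral>x. \<bar>f x - s i x\<bar> \<partial>lborel) < \<epsilon>"
      using eventually_happens'[OF sequentially_bot order_tendstoD(2)[OF conv]] by blast
    then show "\<exists>g. integrable lborel g \<and> (\<integral>x. \<bar>f x - g x\<bar> \<partial>lborel) < \<epsilon> \<and>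
        (\<lambda>n. L1_translation g (a n)) \<longlonglongrightarrow> 0"
      using lim.hyps(1)[of i] lim.IH[of i] by (intro exI[of _ "s i"] conjI)
  qed
qed

section \<open>Large additive noise\<close>

text \<open>The Radon-Nikodym density takes extended values. Total mass 1 makes it finite almost
  everywhere, so \<open>enn2real\<close> changes it only on a null set.\<close>

lemma absolutely_continuous_density:
  assumes D: "prob_space D" "sets D = sets borel" and ac: "absolutely_continuous lborel (D :: real measure)"
  obtains g :: "real \<Rightarrow> real" where "integrable lborel g" "\<And>x. 0 \<le> g x" "D = density lborel (\<lambda>x. ennreal (g x))"
proof -
  interpret D: prob_space D by fact
  obtain f where f[measurable]: "f \<in> borel_measurable lborel" and D_eq: "density lborel f = D"
    using sigma_finite_measure.Radon_Nikodym[OF lborel.sigma_finite_measure_axioms ac] D(2) by auto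
  have total: "(\<integral>\<^sup>+x. f x \<partial>lborel) = 1"
    using D.emeasure_space_1 D_eq[symmetric] by (simp add: emeasure_density)
  then have "AE x in lborel. f x \<noteq> \<infinity>"
    by (intro nn_integral_PInf_AE) auto
  then have AE: "AE x in lborel. f x = ennreal (enn2real (f x))"
    by eventually_elim (auto simp: less_top)
  show ?thesis
  proof (rule that)
    show "D = density lborel (\<lambda>x. ennreal (enn2real (f x)))"
      using AE unfolding D_eq[symmetric] by (intro density_cong) auto
    have "(\<integral>\<^sup>+x. ennreal (enn2real (f x)) \<partial>lborel) = 1"
      using nn_integral_cong_AE[OF AE] total by simp
    then show "integrable lborel (\<lambda>x. enn2real (f x))"
      by (intro integrableI_nonneg) auto
  qed simp
qed

lemma borel_measurable_L1_translation[measurable]: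
  assumes [measurable]: "f \<in> borel_measurable borel"
  shows "L1_translation f \<in> borel_measurable borel"
  unfolding L1_translation_def by measurable

text \<open>Comparison with the zero function. The bound is uniform in \<open>a\<close> and serves
  as the dominating constant below.\<close>

lemma L1_translation_bounded:
  assumes "integrable lborel f"
  shows "L1_translation f a \<le> 2 * (\<integral>x. \<bar>f x\<bar> \<partial>lborel)"
  using L1_translation_le[OF assms, of "\<lambda>_. 0" a] by (simp add: L1_translation_def)

text \<open>Substituting \<open>x - y / \<sigma>\<close> for \<open>x\<close> moves the shift
  \<open>y\<close> from the kernel \<open>k\<close> to the density \<open>g\<close>, whose translate
  is close to \<open>g\<close> in L1; \<open>k\<close> contributes its bound
  \<open>C\<close>.\<close>

lemma noise_kernel_estimate:
  fixes k :: "real \<Rightarrow> real"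
  assumes g: "integrable lborel g" and k[measurable]: "k \<in> borel_measurable borel" and C: "\<And>x. \<bar>k x\<bar> \<le> C"
    and \<sigma>: "0 < \<sigma>"
  shows "\<bar>(\<integral>x. g x * k (y + \<sigma> * x) \<partial>lborel) - (\<integral>x. g x * k (\<sigma> * x) \<partial>lborel)\<bar> \<le> C * L1_translation g (y / \<sigma>)"
proof -
  let ?b = "y / \<sigma>"
  note g' = lborel_integrable_translate[OF g, of ?b]
  have [measurable]: "g \<in> borel_measurable borel"
    using g by simp
  have bnd: "integrable lborel (\<lambda>x. h x * k (\<sigma> * x))" if h: "integrable lborel h" for h
  proof (rule Bochner_Integration.integrable_bound)
    have [measurable]: "h \<in> borel_measurable borel"
      using h by simp
    show "(\<lambda>x. h x * k (\<sigma> * x)) \<in> borel_measurable lborel"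
      by measurable
    show "integrable lborel (\<lambda>x. C * h x)"
      using h by simp
    show "AE x in lborel. norm (h x * k (\<sigma> * x)) \<le> norm (C * h x)"
      using C mult_right_mono[OF order_trans[OF C abs_ge_self], of "\<bar>h _\<bar>"]
      by (auto simp: abs_mult mult.commute)
  qed
  have "(\<integral>x. g x * k (y + \<sigma> * x) \<partial>lborel) = (\<integral>x. g (x - ?b) * k (y + \<sigma> * (x - ?b)) \<partial>lborel)"
    by (rule lborel_integral_translate[symmetric])
  also have "\<dots> = (\<integral>x. g (x - ?b) * k (\<sigma> * x) \<partial>lborel)"
    using \<sigma> by (simp add: right_diff_distrib)
  finally have "\<bar>(\<integral>x. g x * k (y + \<sigma> * x) \<partial>lborel) - (\<integral>x. g x * k (\<sigma> * x) \<partial>lborel)\<bar>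
      = \<bar>\<integral>x. (g (x - ?b) - g x) * k (\<sigma> * x) \<partial>lborel\<bar>"
    using bnd[OF g] bnd[OF g'] by (simp add: left_diff_distrib)
  also have "\<dots> \<le> (\<integral>x. \<bar>(g (x - ?b) - g x) * k (\<sigma> * x)\<bar> \<partial>lborel)"
    by (rule integral_abs_bound)
  also have "\<dots> \<le> (\<integral>x. \<bar>g (x - ?b) - g x\<bar> * C \<partial>lborel)"
  proof (rule integral_mono)
    show "integrable lborel (\<lambda>x. \<bar>(g (x - ?b) - g x) * k (\<sigma> * x)\<bar>)"
      by (intro integrable_abs bnd Bochner_Integration.integrable_diff g g')
  qed (use C g g' in \<open>auto simp: abs_mult intro!: mult_left_mono\<close>)
  also have "\<dots> = C * L1_translation g ?b"
    by (simp add: L1_translation_def mult.commute)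
  finally show ?thesis .
qed

context prob_space
begin

text \<open>For each \<open>\<omega>\<close> the shift \<open>v \<omega> / \<sigma>\<close> tends to
  0, so the integrand tends to 0; the uniform bound on the translation distance gives dominated
  convergence.\<close>

lemma expectation_L1_translation_tendsto:
  assumes g: "integrable lborel g" and v[measurable]: "random_variable borel v"
  shows "((\<lambda>\<sigma>. expectation (\<lambda>\<omega>. L1_translation g (v \<omega> / \<sigma>))) \<longlongrightarrow> 0) at_top"
proof (rule tendsto_at_topI_sequentially)
  fix \<sigma> :: "nat \<Rightarrow> real" assume \<sigma>: "filterlim \<sigma> at_top sequentially"
  have [measurable]: "g \<in> borel_measurable borel"
    using g by simp
  have "(\<lambda>n. expectation (\<lambda>\<omega>. L1_translation g (v \<omega> / \<sigma> n))) \<longlonglongrightarrow> expectation (\<lambda>\<omega>. 0)"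
  proof (rule integral_dominated_convergence[where w = "\<lambda>_. 2 * (\<integral>x. \<bar>g x\<bar> \<partial>lborel)"])
    show "AE \<omega> in M. (\<lambda>n. L1_translation g (v \<omega> / \<sigma> n)) \<longlonglongrightarrow> 0"
    proof (rule AE_I2)
      fix \<omega>
      show "(\<lambda>n. L1_translation g (v \<omega> / \<sigma> n)) \<longlonglongrightarrow> 0"
        by (rule L1_translation_tendsto[OF g real_tendsto_divide_at_top[OF tendsto_const \<sigma>]])
    qed
  qed (use L1_translation_bounded[OF g] in \<open>auto simp: L1_translation_nonneg\<close>)
  then show "(\<lambda>n. expectation (\<lambda>\<omega>. L1_translation g (v \<omega> / \<sigma> n))) \<longlonglongrightarrow> 0"
    by simp
qed

text \<open>The second moment is the mean of \<open>a (v \<omega>)\<close> times a bounded function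
  \<open>k\<close> of the signal. Integrating out the noise turns \<open>k\<close> into a function
  \<open>J\<close> of \<open>v \<omega>\<close> that is nearly constant for large
  \<open>\<sigma>\<close>, and a centered factor annihilates constants. One factor \<open>C\<close>
  bounds \<open>a\<close>, the other bounds \<open>k\<close>.\<close>

lemma moment2_cond_exp_bounded_noise_le:
  fixes a :: "real \<Rightarrow> real"
  assumes v[measurable]: "random_variable borel v" and e[measurable]: "random_variable borel e"
    and ind: "indep_var borel v borel e"
    and g: "integrable lborel g" "\<And>x. 0 \<le> g x" and De: "distr M borel e = density lborel (\<lambda>x. ennreal (g x))"
    and a[measurable]: "a \<in> borel_measurable borel" and a_C: "\<And>x. \<bar>a x\<bar> \<le> C"
    and centered: "expectation (\<lambda>\<omega>. a (v \<omega>)) = 0" and \<sigma>: "0 < \<sigma>"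
  shows "moment2_cond_exp M (\<lambda>\<omega>. a (v \<omega>)) (vimage_algebra (space M) (\<lambda>\<omega>. v \<omega> + \<sigma> * e \<omega>) borel)
    \<le> C * C * expectation (\<lambda>\<omega>. L1_translation g (v \<omega> / \<sigma>))"
proof -
  define s where "s = (\<lambda>\<omega>. v \<omega> + \<sigma> * e \<omega>)"
  let ?u = "\<lambda>\<omega>. a (v \<omega>)"
  let ?F = "vimage_algebra (space M) s borel"
  have [measurable]: "random_variable borel s"
    unfolding s_def by measurable
  have F: "subalgebra M ?F"
    by (rule subalgebra_vimage) measurable
  interpret F: sigma_finite_subalgebra M ?F
    using F by (rule sigma_finite_subalgebra)
  have [measurable]: "g \<in> borel_measurable borel"
    using g(1) by simp
  have C0: "0 \<le> C"
    using a_C[of 0] by simp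
  have u: "random_variable borel ?u" "integrable M ?u"
    using a_C by (auto intro!: integrable_const_bound[where B = C])
  have u2: "integrable M (\<lambda>\<omega>. (?u \<omega>)\<^sup>2)"
    using power_mono[OF a_C abs_ge_zero, of _ 2] by (intro integrable_const_bound[where B = "C\<^sup>2"]) auto
  obtain k\<^sub>0 where k\<^sub>0[measurable]: "k\<^sub>0 \<in> borel_measurable borel"
    and k\<^sub>0_eq: "\<And>\<omega>. \<omega> \<in> space M \<Longrightarrow> real_cond_exp M ?F ?u \<omega> = k\<^sub>0 (s \<omega>)"
    using vimage_algebra_factor[of s "space M" borel "real_cond_exp M ?F ?u"] by auto
  \<comment> \<open>The conditional expectation respects the bound \<open>C\<close> only almost
    everywhere. Clipping gives a version bounded at every point, as the kernel estimate
    requires.\<close>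
  define k where "k = (\<lambda>x. max (- C) (min C (k\<^sub>0 x)))"
  have k[measurable]: "k \<in> borel_measurable borel"
    unfolding k_def by measurable
  have k_C: "\<bar>k x\<bar> \<le> C" for x
    unfolding k_def using C0 by auto
  have "AE \<omega> in M. real_cond_exp M ?F ?u \<omega> \<ge> - C" "AE \<omega> in M. real_cond_exp M ?F ?u \<omega> \<le> C"
    using a_C u by (auto intro!: F.real_cond_exp_ge_c F.real_cond_exp_le_c simp: abs_le_iff minus_le_iff)
  then have ce: "AE \<omega> in M. real_cond_exp M ?F ?u \<omega> = k (s \<omega>)"
    using AE_space by eventually_elim (simp add: k\<^sub>0_eq k_def)

  interpret Dv: prob_space "distr M borel v"
    by (rule prob_space_distr) measurable
  interpret De: prob_space "distr M borel e"
    by (rule prob_space_distr) measurable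
  interpret P: pair_prob_space "distr M borel v" "distr M borel e" ..
  have joint: "distr M borel v \<Otimes>\<^sub>M distr M borel e = distr M (borel \<Otimes>\<^sub>M borel) (\<lambda>\<omega>. (v \<omega>, e \<omega>))"
    using ind by (simp add: indep_var_distribution_eq)
  define J where "J = (\<lambda>y. \<integral>x. g x * k (y + \<sigma> * x) \<partial>lborel)"
  \<comment> \<open>This is \<open>J 0\<close>, the constant near which \<open>J\<close>
    stays.\<close>
  define \<beta> where "\<beta> = (\<integral>x. g x * k (\<sigma> * x) \<partial>lborel)"
  have J_eq: "(\<integral>x. k (y + \<sigma> * x) \<partial>distr M borel e) = J y" for y
    unfolding De J_def using g(2) by (subst integral_density) auto
  have J_meas[measurable]: "J \<in> borel_measurable borel"
    unfolding J_def by measurable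
  have J_est: "\<bar>J y - \<beta>\<bar> \<le> C * L1_translation g (y / \<sigma>)" for y
    unfolding J_def \<beta>_def by (rule noise_kernel_estimate[OF g(1) k k_C \<sigma>])
  have T_int: "integrable M (\<lambda>\<omega>. L1_translation g (v \<omega> / \<sigma>))"
    using L1_translation_bounded[OF g(1)] L1_translation_nonneg[of g]
    by (intro integrable_const_bound[where B = "2 * (\<integral>x. \<bar>g x\<bar> \<partial>lborel)"]) auto
  have uJ_le: "\<bar>?u \<omega> * (J (v \<omega>) - \<beta>)\<bar> \<le> C * C * L1_translation g (v \<omega> / \<sigma>)" for \<omega>
    using mult_mono[OF a_C J_est C0] by (simp add: abs_mult mult.assoc)
  have uJ_int: "integrable M (\<lambda>\<omega>. ?u \<omega> * (J (v \<omega>) - \<beta>))"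
  proof (rule Bochner_Integration.integrable_bound)
    show "integrable M (\<lambda>\<omega>. C * C * L1_translation g (v \<omega> / \<sigma>))"
      using T_int by simp
    show "AE \<omega> in M. norm (?u \<omega> * (J (v \<omega>) - \<beta>)) \<le> norm (C * C * L1_translation g (v \<omega> / \<sigma>))"
      using uJ_le C0 by (auto simp: L1_translation_nonneg)
  qed measurable
  have int: "integrable (distr M borel v \<Otimes>\<^sub>M distr M borel e) (\<lambda>(y, x). a y * k (y + \<sigma> * x))"
    using mult_mono[OF a_C k_C C0] by (intro P.integrable_const_bound[where B = "C * C"]) (auto simp: abs_mult)
  have "moment2_cond_exp M ?u ?F = expectation (\<lambda>\<omega>. ?u \<omega> * real_cond_exp M ?F ?u \<omega>)"
    by (rule moment2_cond_exp_eq[OF u(1) u2 F])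
  also have "\<dots> = expectation (\<lambda>\<omega>. a (v \<omega>) * k (v \<omega> + \<sigma> * e \<omega>))"
    using ce by (intro integral_cong_AE) (auto simp: s_def)
  also have "\<dots> = (\<integral>(y, x). a y * k (y + \<sigma> * x) \<partial>(distr M borel v \<Otimes>\<^sub>M distr M borel e))"
    unfolding joint by (subst integral_distr) auto
  also have "\<dots> = (\<integral>y. a y * J y \<partial>distr M borel v)"
    using P.integral_fst'[OF int] by (simp add: J_eq)
  \<comment> \<open>The last summand has mean 0 because \<open>?u\<close> is centered.\<close>
  also have "\<dots> = expectation (\<lambda>\<omega>. ?u \<omega> * (J (v \<omega>) - \<beta>) + ?u \<omega> * \<beta>)"
    by (subst integral_distr) (auto simp: algebra_simps)
  also have "\<dots> = expectation (\<lambda>\<omega>. ?u \<omega> * (J (v \<omega>) - \<beta>))"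
    using uJ_int u(2) centered by (subst Bochner_Integration.integral_add) auto
  also have "\<dots> \<le> expectation (\<lambda>\<omega>. C * C * L1_translation g (v \<omega> / \<sigma>))"
    using T_int uJ_int order_trans[OF abs_ge_self uJ_le] by (intro integral_mono) auto
  finally show ?thesis
    by (simp add: s_def)
qed

section \<open>From bounded to square integrable variables\<close>

lemma moment2_cond_exp_add_le:
  assumes F: "subalgebra M F"
    and u: "random_variable borel u" "integrable M (\<lambda>\<omega>. (u \<omega>)\<^sup>2)"
    and v: "random_variable borel v" "integrable M (\<lambda>\<omega>. (v \<omega>)\<^sup>2)"
  shows "moment2_cond_exp M (\<lambda>\<omega>. u \<omega> + v \<omega>) F \<le> 2 * moment2_cond_exp M u F + 2 * moment2_cond_exp M v F"
proof -
  interpret F: sigma_finite_subalgebra M F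
    using F by (rule sigma_finite_subalgebra)
  note ui = square_integrable_imp_integrable[OF u] and vi = square_integrable_imp_integrable[OF v]
  note ce = square_integrable_cond_exp[OF u F] square_integrable_cond_exp[OF v F]
  have "moment2_cond_exp M (\<lambda>\<omega>. u \<omega> + v \<omega>) F = expectation (\<lambda>\<omega>. (real_cond_exp M F u \<omega> + real_cond_exp M F v \<omega>)\<^sup>2)"
    unfolding moment2_cond_exp_def using F.real_cond_exp_add[OF ui vi]
    by (intro integral_cong_AE) (auto elim: eventually_mono)
  \<comment> \<open>The cross term is absorbed at the price of a factor 2, so that a truncated part
    and its remainder can be bounded separately.\<close>
  also have "\<dots> \<le> expectation (\<lambda>\<omega>. 2 * (real_cond_exp M F u \<omega>)\<^sup>2 + 2 * (real_cond_exp M F v \<omega>)\<^sup>2)"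
  proof (rule integral_mono)
    show "(x + y)\<^sup>2 \<le> 2 * x\<^sup>2 + 2 * y\<^sup>2" for x y :: real
      using sum_squares_bound[of x y] by (simp add: power2_sum)
  qed (use ce in \<open>auto intro!: square_integrable_add\<close>)
  also have "\<dots> = 2 * moment2_cond_exp M u F + 2 * moment2_cond_exp M v F"
    using ce by (simp add: moment2_cond_exp_def)
  finally show ?thesis .
qed

text \<open>Constants pass through the conditional expectation, so the second summand is the
  variance of the posterior mean.\<close>

lemma moment2_cond_exp_centered:
  assumes F: "subalgebra M F" and v: "random_variable borel v" "integrable M (\<lambda>\<omega>. (v \<omega>)\<^sup>2)"
  shows "moment2_cond_exp M v F = (expectation v)\<^sup>2 + moment2_cond_exp M (\<lambda>\<omega>. v \<omega> - expectation v) F"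
proof -
  interpret F: sigma_finite_subalgebra M F
    using F by (rule sigma_finite_subalgebra)
  let ?m = "expectation v"
  note vi = square_integrable_imp_integrable[OF v]
  have c: "AE \<omega> in M. real_cond_exp M F (\<lambda>_. ?m) \<omega> = ?m"
    by (rule F.real_cond_exp_F_meas) auto
  have "AE \<omega> in M. real_cond_exp M F (\<lambda>\<omega>. v \<omega> - ?m) \<omega>
      = real_cond_exp M F v \<omega> - real_cond_exp M F (\<lambda>_. ?m) \<omega>"
    using vi by (intro F.real_cond_exp_diff) auto
  then have "AE \<omega> in M. (real_cond_exp M F (\<lambda>\<omega>. v \<omega> - ?m) \<omega>)\<^sup>2 = (real_cond_exp M F v \<omega> - ?m)\<^sup>2"
    using c by eventually_elim simp
  then have "moment2_cond_exp M (\<lambda>\<omega>. v \<omega> - ?m) F = expectation (\<lambda>\<omega>. (real_cond_exp M F v \<omega> - ?m)\<^sup>2)"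
    unfolding moment2_cond_exp_def by (intro integral_cong_AE) auto
  also have "\<dots> = expectation (\<lambda>\<omega>. (real_cond_exp M F v \<omega>)\<^sup>2 + ?m\<^sup>2 - 2 * ?m * real_cond_exp M F v \<omega>)"
    by (simp add: power2_diff mult.commute mult.left_commute)
  also have "\<dots> = moment2_cond_exp M v F - ?m\<^sup>2"
    using square_integrable_cond_exp[OF v F] expectation_cond_exp[OF v F]
    by (simp add: moment2_cond_exp_def prob_space power2_eq_square)
  finally show ?thesis
    by simp
qed

text \<open>At each \<open>\<omega>\<close> the remainder vanishes once \<open>n\<close> exceeds
  \<open>\<bar>v \<omega>\<bar>\<close>, and its square is dominated by that of
  \<open>v\<close>.\<close>

lemma truncation_tendsto:
  assumes v[measurable]: "random_variable borel v" and v2: "integrable M (\<lambda>\<omega>. (v \<omega>)\<^sup>2)"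
  shows "(\<lambda>n. expectation (\<lambda>\<omega>. (v \<omega> - max (- real n) (min (real n) (v \<omega>)))\<^sup>2)) \<longlonglongrightarrow> 0"
proof -
  have "(\<lambda>n. expectation (\<lambda>\<omega>. (v \<omega> - max (- real n) (min (real n) (v \<omega>)))\<^sup>2)) \<longlonglongrightarrow> expectation (\<lambda>_. 0)"
  proof (rule integral_dominated_convergence[where w = "\<lambda>\<omega>. (v \<omega>)\<^sup>2"])
    show "AE \<omega> in M. (\<lambda>n. (v \<omega> - max (- real n) (min (real n) (v \<omega>)))\<^sup>2) \<longlonglongrightarrow> 0"
    proof (rule AE_I2)
      fix \<omega>
      obtain n0 where "\<bar>v \<omega>\<bar> \<le> real n0"
        using real_arch_simple by blast
      then have "(v \<omega> - max (- real n) (min (real n) (v \<omega>)))\<^sup>2 = 0" if "n \<ge> n0" for n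
      proof -
        have "\<bar>v \<omega>\<bar> \<le> real n"
          using \<open>\<bar>v \<omega>\<bar> \<le> real n0\<close> that by linarith
        then show ?thesis
          by simp
      qed
      then show "(\<lambda>n. (v \<omega> - max (- real n) (min (real n) (v \<omega>)))\<^sup>2) \<longlonglongrightarrow> 0"
        by (intro tendsto_eventually eventually_sequentiallyI)
    qed
    show "AE \<omega> in M. norm ((v \<omega> - max (- real n) (min (real n) (v \<omega>)))\<^sup>2) \<le> (v \<omega>)\<^sup>2" for n
      by (intro AE_I2) (auto simp: abs_le_square_iff[symmetric])
  qed (use v2 in auto)
  then show ?thesis
    by simp
qed

text \<open>The centered \<open>v\<close> is split into a bounded centered part
  \<open>a (v \<omega>)\<close> and a centered remainder \<open>r\<^sub>0\<close>. The remainder is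
  bounded by its own second moment for every \<open>\<sigma>\<close>; for the bounded part,
  \<open>\<sigma>\<close> is taken large after the truncation level \<open>n\<close> is
  fixed.\<close>

lemma moment2_cond_exp_large_noise:
  assumes v[measurable]: "random_variable borel v" and e[measurable]: "random_variable borel e"
    and ind: "indep_var borel v borel e" and v2: "integrable M (\<lambda>\<omega>. (v \<omega>)\<^sup>2)"
    and ac: "absolutely_continuous lborel (distr M borel e)" and \<epsilon>: "0 < \<epsilon>"
  shows "\<forall>\<^sub>F \<sigma> in at_top. moment2_cond_exp M v (vimage_algebra (space M) (\<lambda>\<omega>. v \<omega> + \<sigma> * e \<omega>) borel)
    < (expectation v)\<^sup>2 + \<epsilon>"
proof -
  obtain g where g: "integrable lborel g" "\<And>x. 0 \<le> g x" "distr M borel e = density lborel (\<lambda>x. ennreal (g x))"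
    using absolutely_continuous_density[OF prob_space_distr[OF e] _ ac] by auto
  \<comment> \<open>Both parts enter with the factor 2 from the splitting, so each is made smaller
    than \<open>\<epsilon> / 4\<close>.\<close>
  have "\<forall>\<^sub>F n in sequentially. expectation (\<lambda>\<omega>. (v \<omega> - max (- real n) (min (real n) (v \<omega>)))\<^sup>2) < \<epsilon> / 4"
    using \<epsilon> by (intro order_tendstoD(2)[OF truncation_tendsto[OF v v2]]) simp
  then obtain n where n: "expectation (\<lambda>\<omega>. (v \<omega> - max (- real n) (min (real n) (v \<omega>)))\<^sup>2) < \<epsilon> / 4"
    using eventually_happens'[OF sequentially_bot] by blast
  define t where "t = (\<lambda>x. max (- real n) (min (real n) x))"
  define \<alpha> where "\<alpha> = expectation (\<lambda>\<omega>. t (v \<omega>))"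
  define a where "a = (\<lambda>x. t x - \<alpha>)"
  define r where "r = (\<lambda>\<omega>. v \<omega> - t (v \<omega>))"
  have [measurable]: "t \<in> borel_measurable borel" "a \<in> borel_measurable borel" "random_variable borel r"
    unfolding a_def r_def t_def by measurable
  have t_n: "\<bar>t x\<bar> \<le> n" for x
    unfolding t_def by auto
  have t_int[simp]: "integrable M (\<lambda>\<omega>. t (v \<omega>))"
    using t_n by (intro integrable_const_bound[where B = n]) auto
  have "\<bar>\<alpha>\<bar> \<le> expectation (\<lambda>\<omega>. \<bar>t (v \<omega>)\<bar>)"
    unfolding \<alpha>_def by (rule integral_abs_bound)
  also have "\<dots> \<le> expectation (\<lambda>\<omega>. real n)"
    using t_n by (intro integral_mono) auto
  finally have a_n: "\<bar>a x\<bar> \<le> 2 * real n" for x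
    using t_n[of x] unfolding a_def by (simp add: prob_space)
  have a_mean: "expectation (\<lambda>\<omega>. a (v \<omega>)) = 0"
    by (simp add: a_def \<alpha>_def prob_space)
  have a2: "integrable M (\<lambda>\<omega>. (a (v \<omega>))\<^sup>2)"
    using power_mono[OF a_n abs_ge_zero, of _ 2] by (intro integrable_const_bound[where B = "(2 * real n)\<^sup>2"]) auto
  have r2: "integrable M (\<lambda>\<omega>. (r \<omega>)\<^sup>2)"
  proof (rule Bochner_Integration.integrable_bound[OF v2])
    show "AE \<omega> in M. norm ((r \<omega>)\<^sup>2) \<le> norm ((v \<omega>)\<^sup>2)"
      by (intro AE_I2) (auto simp: abs_le_square_iff[symmetric] r_def t_def)
  qed measurable
  note vi = square_integrable_imp_integrable[OF v v2] and ri = square_integrable_imp_integrable[OF _ r2]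
  define r\<^sub>0 where "r\<^sub>0 = (\<lambda>\<omega>. r \<omega> - expectation r)"
  have [measurable]: "random_variable borel r\<^sub>0"
    unfolding r\<^sub>0_def by measurable
  have r\<^sub>02: "integrable M (\<lambda>\<omega>. (r\<^sub>0 \<omega>)\<^sup>2)"
    using square_integrable_add[of r M "\<lambda>_. - expectation r"] r2 by (simp add: r\<^sub>0_def)
  \<comment> \<open>A variance is at most the second moment, so centering preserves
    smallness.\<close>
  have "expectation (\<lambda>\<omega>. (r\<^sub>0 \<omega>)\<^sup>2) \<le> expectation (\<lambda>\<omega>. (r \<omega>)\<^sup>2)"
    using variance_eq[OF ri r2] by (simp add: r\<^sub>0_def)
  then have r\<^sub>0_small: "expectation (\<lambda>\<omega>. (r\<^sub>0 \<omega>)\<^sup>2) < \<epsilon> / 4"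
    using n by (simp add: r_def t_def)
  have split: "v \<omega> - expectation v = a (v \<omega>) + r\<^sub>0 \<omega>" for \<omega>
    using vi by (simp add: a_def r\<^sub>0_def r_def \<alpha>_def)
  have "((\<lambda>\<sigma>. 4 * real n * real n * expectation (\<lambda>\<omega>. L1_translation g (v \<omega> / \<sigma>))) \<longlongrightarrow> 0) at_top"
    by (rule tendsto_mult_right_zero[OF expectation_L1_translation_tendsto[OF g(1) v]])
  then have "\<forall>\<^sub>F \<sigma> in at_top. 4 * real n * real n * expectation (\<lambda>\<omega>. L1_translation g (v \<omega> / \<sigma>)) < \<epsilon> / 4"
    using \<epsilon> by (intro order_tendstoD(2)) auto
  then show ?thesis
    using eventually_gt_at_top[of 0]
  proof eventually_elim
    case (elim \<sigma>)
    let ?F = "vimage_algebra (space M) (\<lambda>\<omega>. v \<omega> + \<sigma> * e \<omega>) borel"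
    have F: "subalgebra M ?F"
      by (rule subalgebra_vimage) measurable
    have "moment2_cond_exp M v ?F = (expectation v)\<^sup>2 + moment2_cond_exp M (\<lambda>\<omega>. a (v \<omega>) + r\<^sub>0 \<omega>) ?F"
      using moment2_cond_exp_centered[OF F v v2] by (simp add: split)
    also have "moment2_cond_exp M (\<lambda>\<omega>. a (v \<omega>) + r\<^sub>0 \<omega>) ?F
        \<le> 2 * moment2_cond_exp M (\<lambda>\<omega>. a (v \<omega>)) ?F + 2 * moment2_cond_exp M r\<^sub>0 ?F"
      using a2 r\<^sub>02 by (intro moment2_cond_exp_add_le F) auto
    also have "moment2_cond_exp M r\<^sub>0 ?F \<le> expectation (\<lambda>\<omega>. (r\<^sub>0 \<omega>)\<^sup>2)"
      using r\<^sub>02 by (intro moment2_cond_exp_le F) auto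
    also have "moment2_cond_exp M (\<lambda>\<omega>. a (v \<omega>)) ?F
        \<le> (2 * real n) * (2 * real n) * expectation (\<lambda>\<omega>. L1_translation g (v \<omega> / \<sigma>))"
      using elim a_mean a_n g ind by (intro moment2_cond_exp_bounded_noise_le) auto
    finally show ?case
      using elim r\<^sub>0_small by simp
  qed
qed

end

section \<open>Data sharing\<close>

context prob_space
begin

text \<open>Insert the affine estimator \<open>expectation v + t * Y \<omega>\<close> into the
  variational bound. The coefficient \<open>t\<close> stays free and is chosen in each
  application.\<close>

lemma moment2_cond_exp_gain:
  assumes v: "random_variable borel v" and v2: "integrable M (\<lambda>\<omega>. (v \<omega>)\<^sup>2)" and F: "subalgebra M F"
    and Y: "Y \<in> borel_measurable F" and Y2: "integrable M (\<lambda>\<omega>. (Y \<omega>)\<^sup>2)" and Y0: "expectation Y = 0"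
  shows "(expectation v)\<^sup>2 + 2 * t * expectation (\<lambda>\<omega>. v \<omega> * Y \<omega>) - t\<^sup>2 * expectation (\<lambda>\<omega>. (Y \<omega>)\<^sup>2)
    \<le> moment2_cond_exp M v F"
proof -
  let ?m = "expectation v" and ?Z = "\<lambda>\<omega>. expectation v + t * Y \<omega>"
  have Ym[measurable]: "random_variable borel Y"
    using Y measurable_from_subalg[OF F] by blast
  note Yi = square_integrable_imp_integrable[OF Ym Y2] and vi = square_integrable_imp_integrable[OF v v2]
  have Z2: "integrable M (\<lambda>\<omega>. (?Z \<omega>)\<^sup>2)"
    using Y2 by (intro square_integrable_add) (auto simp: power_mult_distrib)
  have "expectation (\<lambda>\<omega>. v \<omega> * ?Z \<omega>) = expectation (\<lambda>\<omega>. ?m * v \<omega> + t * (v \<omega> * Y \<omega>))"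
    by (simp add: algebra_simps)
  also have "\<dots> = ?m\<^sup>2 + t * expectation (\<lambda>\<omega>. v \<omega> * Y \<omega>)"
    using vi square_integrable_mult[OF v Ym v2 Y2] by (simp add: power2_eq_square)
  finally have vZ: "expectation (\<lambda>\<omega>. v \<omega> * ?Z \<omega>) = ?m\<^sup>2 + t * expectation (\<lambda>\<omega>. v \<omega> * Y \<omega>)" .
  have "expectation (\<lambda>\<omega>. (?Z \<omega>)\<^sup>2) = expectation (\<lambda>\<omega>. ?m\<^sup>2 + 2 * ?m * t * Y \<omega> + t\<^sup>2 * (Y \<omega>)\<^sup>2)"
    by (simp add: power2_sum power_mult_distrib algebra_simps)
  also have "\<dots> = ?m\<^sup>2 + t\<^sup>2 * expectation (\<lambda>\<omega>. (Y \<omega>)\<^sup>2)"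
    using Yi Y2 Y0 by (simp add: prob_space)
  finally show ?thesis
    using moment2_cond_exp_variational[OF v v2 F _ Z2] Y vZ by simp
qed

end

context social_data
begin

section \<open>Independence and moments of the fundamentals and the error\<close>

lemma consumers_nonempty: "{..<N} \<noteq> {}"
proof -
  have "0 \<in> {..<N}"
    using two_consumers by simp
  then show ?thesis
    by blast
qed

lemma w_rv: "i < N \<Longrightarrow> random_variable borel (w i)"
  using w_indep by (simp add: indep_vars_def)

lemma w_vector_rv: "random_variable (\<Pi>\<^sub>M i\<in>{..<N}. borel) (\<lambda>\<omega>. \<lambda>i\<in>{..<N}. w i \<omega>)"
  using w_rv by (intro measurable_restrict) auto

lemma w_integrable: "i < N \<Longrightarrow> integrable M (w i)"
  using square_integrable_imp_integrable w_rv w_square_integrable by blast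

lemma e_integrable: "integrable M e"
  using square_integrable_imp_integrable[OF e_rv e_square_integrable] .

text \<open>The error is appended to the fundamentals at index \<open>N\<close>, so that all
  independence assumptions on them become one statement about a single family.\<close>

definition primitives :: "nat \<Rightarrow> 'a \<Rightarrow> real" where
  "primitives j = (if j < N then w j else e)"

lemma primitives_simps: "j < N \<Longrightarrow> primitives j = w j" "primitives N = e"
  by (auto simp: primitives_def)

text \<open>Product formula on rectangles: index \<open>N\<close> splits off because
  \<open>e\<close> is independent of the whole vector of fundamentals, and the rest factors by their
  mutual independence.\<close>

lemma indep_vars_primitives: "indep_vars (\<lambda>_. borel) primitives {..N}"
proof (subst indep_vars_finite[where E = "\<lambda>_. sets borel"])
  show "\<forall>A\<in>{..N} \<rightarrow> sets borel. prob (\<Inter>j\<in>{..N}. primitives j -` A j \<inter> space M)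
      = (\<Prod>j\<in>{..N}. prob (primitives j -` A j \<inter> space M))"
  proof
    fix A assume "A \<in> {..N} \<rightarrow> sets (borel :: real measure)"
    then have A: "\<And>j. j \<le> N \<Longrightarrow> A j \<in> sets borel"
      by auto
    let ?W = "\<lambda>\<omega>. \<lambda>i\<in>{..<N}. w i \<omega>"
    let ?B = "\<Pi>\<^sub>E j\<in>{..<N}. A j"
    have N: "{..N} = insert N {..<N}" "{..<N} \<noteq> {}"
      using consumers_nonempty by auto
    have w_part: "?W -` ?B \<inter> space M = (\<Inter>j\<in>{..<N}. w j -` A j \<inter> space M)"
      using N(2) by (auto simp: PiE_iff)
    have "(\<Inter>j\<in>{..N}. primitives j -` A j \<inter> space M) = (e -` A N \<inter> space M) \<inter> (?W -` ?B \<inter> space M)"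
      unfolding w_part by (auto simp: N(1) primitives_simps)
    moreover have "prob ((e -` A N \<inter> space M) \<inter> (?W -` ?B \<inter> space M))
        = prob (e -` A N \<inter> space M) * prob (?W -` ?B \<inter> space M)"
      using A by (intro indep_setD[OF e_indep_w] in_vimage_algebra sets_PiM_I_finite) auto
    moreover have "prob (?W -` ?B \<inter> space M) = (\<Prod>j\<in>{..<N}. prob (w j -` A j \<inter> space M))"
      unfolding w_part using A N(2) by (intro indep_varsD[OF w_indep]) auto
    ultimately show "prob (\<Inter>j\<in>{..N}. primitives j -` A j \<inter> space M)
        = (\<Prod>j\<in>{..N}. prob (primitives j -` A j \<inter> space M))"
      by (simp add: N(1) primitives_simps)
  qed
  show "sets borel = sigma_sets (space borel) (sets borel)" for j
    by (rule sets.sigma_sets_eq[symmetric])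
qed (use w_rv e_rv in \<open>auto simp: primitives_def Int_stable_def\<close>)

text \<open>Grouping an independent family into \<open>{i}\<close> and the rest. The map
  \<open>f\<close> is general: coordinates give pairwise independence, and a vector of sums gives
  the signals of the other consumers.\<close>

lemma indep_set_w_others:
  assumes i: "i < N" and f: "f \<in> measurable (\<Pi>\<^sub>M j\<in>{..N} - {i}. borel) K"
  shows "indep_set (sets (vimage_algebra (space M) (w i) borel))
    (sets (vimage_algebra (space M) (\<lambda>\<omega>. f (\<lambda>j\<in>{..N} - {i}. primitives j \<omega>)) K))"
proof -
  have "indep_var (PiM {i} (\<lambda>_. borel)) (\<lambda>\<omega>. \<lambda>j\<in>{i}. primitives j \<omega>)
      (PiM ({..N} - {i}) (\<lambda>_. borel)) (\<lambda>\<omega>. \<lambda>j\<in>{..N} - {i}. primitives j \<omega>)"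
    using i by (intro indep_var_restrict[OF indep_vars_primitives]) auto
  then have ind: "indep_set (sets (vimage_algebra (space M) (\<lambda>\<omega>. \<lambda>j\<in>{i}. primitives j \<omega>) (PiM {i} (\<lambda>_. borel))))
      (sets (vimage_algebra (space M) (\<lambda>\<omega>. \<lambda>j\<in>{..N} - {i}. primitives j \<omega>) (PiM ({..N} - {i}) (\<lambda>_. borel))))"
    and rv: "random_variable (PiM {i} (\<lambda>_. borel)) (\<lambda>\<omega>. \<lambda>j\<in>{i}. primitives j \<omega>)"
      "random_variable (PiM ({..N} - {i}) (\<lambda>_. borel)) (\<lambda>\<omega>. \<lambda>j\<in>{..N} - {i}. primitives j \<omega>)"
    by (auto simp: indep_var_eq sets_vimage_algebra)
  have "(\<lambda>x. x i) \<in> measurable (PiM {i} (\<lambda>_. borel)) (borel :: real measure)"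
    by measurable
  from indep_set_vimage_compose[OF ind rv this f] i show ?thesis
    by (simp add: primitives_simps)
qed

lemma indep_w_e: "i < N \<Longrightarrow> indep_var borel (w i) borel e"
  using indep_set_w_others[of i "\<lambda>x. x N" borel] w_rv[of i] e_rv
  by (simp add: indep_var_eq sets_vimage_algebra primitives_simps)

lemma indep_w_w: "i < N \<Longrightarrow> j < N \<Longrightarrow> j \<noteq> i \<Longrightarrow> indep_var borel (w i) borel (w j)"
  using indep_set_w_others[of i "\<lambda>x. x j" borel] w_rv[of i] w_rv[of j]
  by (simp add: indep_var_eq sets_vimage_algebra primitives_simps)

lemma expectation_w_w:
  assumes "i < N" "j < N"
  shows "expectation (\<lambda>\<omega>. w i \<omega> * w j \<omega>) = \<mu>\<^sup>2 + (if i = j then 1 else 0)"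
proof (cases "i = j")
  case True
  then show ?thesis
    using variance_eq[OF w_integrable[of i] w_square_integrable[of i]] assms w_mean[of i] w_variance[of i]
    by (simp add: power2_eq_square)
next
  case False
  then show ?thesis
    using indep_var_lebesgue_integral[OF indep_w_w[of i j] w_integrable[of i] w_integrable[of j]] assms w_mean
    by (simp add: power2_eq_square)
qed

lemma expectation_w_e: "i < N \<Longrightarrow> expectation (\<lambda>\<omega>. w i \<omega> * e \<omega>) = 0"
  using indep_var_lebesgue_integral[OF indep_w_e[of i] w_integrable[of i] e_integrable] e_mean by simp

lemma w_w_integrable: "i < N \<Longrightarrow> j < N \<Longrightarrow> integrable M (\<lambda>\<omega>. w i \<omega> * w j \<omega>)"
  by (intro square_integrable_mult w_rv w_square_integrable)

lemma w_e_integrable: "i < N \<Longrightarrow> integrable M (\<lambda>\<omega>. w i \<omega> * e \<omega>)"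
  by (intro square_integrable_mult w_rv w_square_integrable e_rv e_square_integrable)

text \<open>The sum is \<open>N\<close> times the deviation of \<open>w i\<close> from the average
  fundamental. In each difference the terms \<open>\<mu>\<^sup>2\<close> cancel, and only the unit
  variances remain.\<close>

lemma expectation_w_contrast:
  assumes i: "i < N" and j: "j < N"
  shows "integrable M (\<lambda>\<omega>. w j \<omega> * (\<Sum>k<N. w i \<omega> - w k \<omega>))"
    and "expectation (\<lambda>\<omega>. w j \<omega> * (\<Sum>k<N. w i \<omega> - w k \<omega>)) = (if j = i then real N else 0) - 1"
proof -
  have eq: "w j \<omega> * (\<Sum>k<N. w i \<omega> - w k \<omega>) = (\<Sum>k<N. w j \<omega> * w i \<omega> - w j \<omega> * w k \<omega>)" for \<omega>
    by (simp add: sum_distrib_left right_diff_distrib)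
  show "integrable M (\<lambda>\<omega>. w j \<omega> * (\<Sum>k<N. w i \<omega> - w k \<omega>))"
    unfolding eq using i j w_w_integrable by auto
  have "expectation (\<lambda>\<omega>. w j \<omega> * (\<Sum>k<N. w i \<omega> - w k \<omega>))
      = (\<Sum>k<N. (if j = i then 1 else 0) - (if j = k then 1 else 0))"
    unfolding eq using i j w_w_integrable
    by (subst Bochner_Integration.integral_sum) (auto simp: expectation_w_w intro!: sum.cong)
  also have "\<dots> = (if j = i then real N else 0) - 1"
    using j by (simp add: sum_subtractf)
  finally show "expectation (\<lambda>\<omega>. w j \<omega> * (\<Sum>k<N. w i \<omega> - w k \<omega>)) = (if j = i then real N else 0) - 1" .
qed

text \<open>Expanding one factor of the square leaves products of a fundamental with the contrast,
  whose means are known.\<close>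

lemma expectation_contrast_square:
  assumes i: "i < N"
  shows "expectation (\<lambda>\<omega>. (\<Sum>k<N. w i \<omega> - w k \<omega>)\<^sup>2) = real N * (real N - 1)"
proof -
  let ?Y = "\<lambda>\<omega>. \<Sum>k<N. w i \<omega> - w k \<omega>"
  have "(?Y \<omega>)\<^sup>2 = (\<Sum>j<N. w i \<omega> * ?Y \<omega> - w j \<omega> * ?Y \<omega>)" for \<omega>
    by (simp add: power2_eq_square sum_distrib_right left_diff_distrib)
  then have "expectation (\<lambda>\<omega>. (?Y \<omega>)\<^sup>2) = (\<Sum>j<N. real N - (if j = i then real N else 0))"
    using i expectation_w_contrast
    by (simp only:) (subst Bochner_Integration.integral_sum, auto intro!: sum.cong)
  also have "\<dots> = real N * (real N - 1)"
    using i by (simp add: sum_subtractf algebra_simps)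
  finally show ?thesis .
qed

abbreviation s :: "real \<Rightarrow> nat \<Rightarrow> 'a \<Rightarrow> real" where
  "s \<equiv> signal w e"

abbreviation collected :: "nat set \<Rightarrow> bool" where
  "collected B \<equiv> B = {..<N} \<or> (\<exists>i<N. B = {..<N} - {i})"

lemma s_rv: "i < N \<Longrightarrow> random_variable borel (s \<sigma> i)"
  using w_rv[of i] e_rv unfolding signal_def[abs_def] by measurable

lemma own_info_subalgebra: "i < N \<Longrightarrow> subalgebra M (own_info M (s \<sigma>) i)"
  unfolding own_info_def by (intro subalgebra_vimage s_rv)

section \<open>Surplus and profit for a policy that preserves the total of the signals\<close>

context
  fixes \<sigma> :: real and X :: "nat set \<Rightarrow> 'a \<Rightarrow> nat \<Rightarrow> real"
  assumes X_rv: "\<And>B. collected B \<Longrightarrow> random_variable (\<Pi>\<^sub>M j\<in>B. borel) (X B)"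
    and X_sum: "\<And>\<omega>. \<omega> \<in> space M \<Longrightarrow> (\<Sum>j<N. X {..<N} \<omega> j) = (\<Sum>j<N. s \<sigma> j \<omega>)"
begin

lemma data_info_subalgebra: "collected B \<Longrightarrow> subalgebra M (data_info M X B)"
  unfolding data_info_def by (intro subalgebra_vimage X_rv)

lemma joint_rv: "i < N \<Longrightarrow> collected B \<Longrightarrow> random_variable (borel \<Otimes>\<^sub>M (\<Pi>\<^sub>M j\<in>B. borel)) (\<lambda>\<omega>. (s \<sigma> i \<omega>, X B \<omega>))"
  by (intro measurable_Pair s_rv X_rv)

lemma joint_info_subalgebra: "i < N \<Longrightarrow> collected B \<Longrightarrow> subalgebra M (joint_info M (s \<sigma>) X i B)"
  unfolding joint_info_def by (intro subalgebra_vimage joint_rv)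

lemma data_info_le_joint_info:
  assumes "i < N" "collected B"
  shows "sets (data_info M X B) \<subseteq> sets (joint_info M (s \<sigma>) X i B)"
  using sets_vimage_algebra_compose[of "\<lambda>\<omega>. (s \<sigma> i \<omega>, X B \<omega>)" "space M" _ snd, OF _ measurable_snd]
    measurable_space[OF joint_rv[OF assms]]
  unfolding data_info_def joint_info_def by auto

text \<open>\<open>N\<close> times the own signal minus the total of the data is the contrast
  \<open>?Y\<close>. The common error cancels, so the bound does not depend on
  \<open>\<sigma>\<close>.\<close>

lemma joint_info_moment_ge:
  assumes i: "i < N"
  shows "\<mu>\<^sup>2 + 1 / 2 \<le> moment2_cond_exp M (w i) (joint_info M (s \<sigma>) X i {..<N})"
proof -
  let ?G = "joint_info M (s \<sigma>) X i {..<N}"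
  let ?Y = "\<lambda>\<omega>. \<Sum>k<N. w i \<omega> - w k \<omega>"
  have G: "subalgebra M ?G"
    using i by (intro joint_info_subalgebra) auto
  have pair: "(\<lambda>\<omega>. (s \<sigma> i \<omega>, X {..<N} \<omega>)) \<in> measurable ?G (borel \<Otimes>\<^sub>M (\<Pi>\<^sub>M j\<in>{..<N}. borel))"
    unfolding joint_info_def using measurable_space[OF joint_rv[OF i, of "{..<N}"]]
    by (intro measurable_vimage_algebra1) auto
  have "(\<lambda>p::real \<times> (nat \<Rightarrow> real). \<Sum>j<N. fst p - snd p j) \<in> borel_measurable (borel \<Otimes>\<^sub>M (\<Pi>\<^sub>M j\<in>{..<N}. borel))"
    by (intro borel_measurable_sum borel_measurable_diff measurable_fst
        measurable_compose[OF measurable_snd measurable_component_singleton])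
  from measurable_compose[OF pair this]
  have "(\<lambda>\<omega>. \<Sum>j<N. s \<sigma> i \<omega> - X {..<N} \<omega> j) \<in> borel_measurable ?G"
    by simp
  moreover have "(\<Sum>j<N. s \<sigma> i \<omega> - X {..<N} \<omega> j) = ?Y \<omega>" if "\<omega> \<in> space ?G" for \<omega>
    using X_sum[of \<omega>] that G by (simp add: sum_subtractf signal_def sum.distrib subalgebra_def algebra_simps)
  ultimately have Y: "?Y \<in> borel_measurable ?G"
    by (simp cong: measurable_cong)
  have Y2: "integrable M (\<lambda>\<omega>. (?Y \<omega>)\<^sup>2)"
  proof (intro square_integrable_sum)
    fix k assume "k \<in> {..<N}"
    then show "random_variable borel (\<lambda>\<omega>. w i \<omega> - w k \<omega>)" "integrable M (\<lambda>\<omega>. (w i \<omega> - w k \<omega>)\<^sup>2)"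
      using i w_rv w_square_integrable w_w_integrable
      by (auto simp: power2_diff mult.assoc)
  qed simp
  have Y0: "expectation ?Y = 0"
    using i w_mean w_integrable by (subst Bochner_Integration.integral_sum) auto
  have N: "real N \<ge> 2"
    using two_consumers by simp
  \<comment> \<open>The value \<open>1 / N\<close> is the regression coefficient of
    \<open>w i\<close> on \<open>?Y\<close>. It yields the gain \<open>1 - 1 / N\<close>, which is
    at least 1/2 for two or more consumers.\<close>
  have "\<mu>\<^sup>2 + 2 * (1 / N) * (real N - 1) - (1 / N)\<^sup>2 * (real N * (real N - 1)) \<le> moment2_cond_exp M (w i) ?G"
    using moment2_cond_exp_gain[OF w_rv[OF i] w_square_integrable[OF i] G Y Y2 Y0, of "1 / N"]
      expectation_w_contrast(2)[OF i i] expectation_contrast_square[OF i] w_mean[OF i]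
    by simp
  moreover have "2 * (1 / N) * (real N - 1) - (1 / N)\<^sup>2 * (real N * (real N - 1)) = 1 - 1 / N"
    using N by (simp add: field_simps power2_eq_square)
  moreover have "1 / real N \<le> 1 / 2"
    using N by (simp add: field_simps)
  ultimately show ?thesis
    by linarith
qed

text \<open>The centered total of the signals has covariance 1 with \<open>w i\<close>, so a small
  positive multiple of it improves on the constant estimator.\<close>

lemma data_info_moment_gt:
  assumes i: "i < N"
  shows "\<mu>\<^sup>2 < moment2_cond_exp M (w i) (data_info M X {..<N})"
proof -
  let ?G = "data_info M X {..<N}"
  let ?Y = "\<lambda>\<omega>. \<Sum>j<N. (w j \<omega> - \<mu>) + \<sigma> * e \<omega>"
  have G: "subalgebra M ?G"
    by (intro data_info_subalgebra) auto
  have X: "X {..<N} \<in> measurable ?G (\<Pi>\<^sub>M j\<in>{..<N}. borel)"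
    unfolding data_info_def using measurable_space[OF X_rv[of "{..<N}"]]
    by (intro measurable_vimage_algebra1) auto
  have "(\<lambda>x. \<Sum>j<N. x j - \<mu>) \<in> borel_measurable (\<Pi>\<^sub>M j\<in>{..<N}. borel)"
    by (intro borel_measurable_sum borel_measurable_diff measurable_component_singleton) auto
  from measurable_compose[OF X this]
  have "(\<lambda>\<omega>. \<Sum>j<N. X {..<N} \<omega> j - \<mu>) \<in> borel_measurable ?G" .
  moreover have "(\<Sum>j<N. X {..<N} \<omega> j - \<mu>) = ?Y \<omega>" if "\<omega> \<in> space ?G" for \<omega>
    using X_sum[of \<omega>] that G by (simp add: sum_subtractf signal_def sum.distrib subalgebra_def algebra_simps)
  ultimately have Y: "?Y \<in> borel_measurable ?G"
    by (simp cong: measurable_cong)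
  have sq: "integrable M (\<lambda>\<omega>. (w j \<omega> - \<mu>)\<^sup>2)" if "j < N" for j
    using square_integrable_add[of "w j" M "\<lambda>_. - \<mu>"] that w_rv w_square_integrable by auto
  have Y2: "integrable M (\<lambda>\<omega>. (?Y \<omega>)\<^sup>2)"
    using w_rv e_rv sq e_square_integrable
    by (intro square_integrable_sum square_integrable_add) (auto simp: power_mult_distrib)
  have Y0: "expectation ?Y = 0"
    using w_mean w_integrable e_integrable e_mean by (subst Bochner_Integration.integral_sum) (auto simp: prob_space)
  have eq: "w i \<omega> * ?Y \<omega> = (\<Sum>j<N. w i \<omega> * w j \<omega> - \<mu> * w i \<omega> + \<sigma> * (w i \<omega> * e \<omega>))" for \<omega>
    by (simp add: sum_distrib_left algebra_simps)
  have wY: "expectation (\<lambda>\<omega>. w i \<omega> * ?Y \<omega>) = 1"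
    unfolding eq using i w_w_integrable w_e_integrable w_integrable w_mean
    by (subst Bochner_Integration.integral_sum)
      (auto simp: expectation_w_w expectation_w_e power2_eq_square)
  define q where "q = expectation (\<lambda>\<omega>. (?Y \<omega>)\<^sup>2)"
  \<comment> \<open>The gain is positive as soon as \<open>t * q < 2\<close>. This choice gives
    \<open>t * q = 1 - t\<close> and is well defined even for \<open>q = 0\<close>.\<close>
  define t where "t = 1 / (1 + q)"
  have "0 \<le> q"
    by (simp add: q_def)
  then have t: "0 < t" "t * q = 1 - t"
    by (auto simp: t_def field_simps)
  then have "t * (t * q) < t * 2"
    by (intro mult_strict_left_mono) auto
  moreover have "\<mu>\<^sup>2 + 2 * t - t\<^sup>2 * q \<le> moment2_cond_exp M (w i) ?G"
    using moment2_cond_exp_gain[OF w_rv[OF i] w_square_integrable[OF i] G Y Y2 Y0, of t] wY w_mean[OF i]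
    by (simp add: q_def)
  ultimately show ?thesis
    by (simp add: power2_eq_square mult.assoc)
qed

text \<open>The producer's information enters with weight -1/8 and is bounded by the consumer's,
  which leaves 3/8 of the consumer's second moment. The latter exceeds \<open>\<mu>\<^sup>2\<close>
  by at least 1/2, a contribution of 3/16, and this is half of the 3/8 allowed for the own
  signal.\<close>

lemma social_surplus_gain_pos:
  assumes i: "i < N" and own: "moment2_cond_exp M (w i) (own_info M (s \<sigma>) i) < \<mu>\<^sup>2 + 3 / 8"
  shows "0 < social_surplus_gain M N c w (s \<sigma>) X i"
proof -
  let ?V = "moment2_cond_exp M (w i)"
  let ?SX = "joint_info M (s \<sigma>) X i {..<N}" and ?X = "data_info M X {..<N}"
  note wi = w_rv[OF i] w_square_integrable[OF i]
  have SX: "subalgebra M ?SX" and X: "subalgebra M ?X" and sub: "sets ?X \<subseteq> sets ?SX"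
    using i data_info_le_joint_info[OF i, of "{..<N}"]
    by (auto intro!: joint_info_subalgebra data_info_subalgebra)
  note none = moment2_no_info[OF w_integrable[OF i]]
  have none_sub: "sets (no_info M) \<subseteq> sets (own_info M (s \<sigma>) i)"
    using own_info_subalgebra[OF i, of \<sigma>] sets.top[of "own_info M (s \<sigma>) i"] by (auto simp: no_info_def sigma_sets_empty_eq subalgebra_def)
  have "?V ?X \<le> ?V ?SX"
    using wi X SX sub by (rule moment2_cond_exp_mono)
  moreover have "social_surplus_gain M N c w (s \<sigma>) X i
      = ?V ?SX / 2 - ?V ?X / 8 - ?V (own_info M (s \<sigma>) i) / 2 + \<mu>\<^sup>2 / 8"
    unfolding social_surplus_gain_def social_surplus_def
      producer_surplus_eq[OF wi SX X sub] consumer_surplus_eq[OF wi SX X sub]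
      producer_surplus_eq[OF wi own_info_subalgebra[OF i] none(1) none_sub]
      consumer_surplus_eq[OF wi own_info_subalgebra[OF i] none(1) none_sub]
      none(2) w_mean[OF i]
    by (simp add: field_simps)
  ultimately show ?thesis
    using own joint_info_moment_ge[OF i] by simp
qed

lemma intermediary_profit_neg:
  assumes others: "\<And>i. i < N \<Longrightarrow> moment2_cond_exp M (w i) (data_info M X ({..<N} - {i})) \<le> \<mu>\<^sup>2"
    and own_data: "\<And>i. i < N \<Longrightarrow> moment2_cond_exp M (w i) (joint_info M (s \<sigma>) X i {..<N})
      \<le> moment2_cond_exp M (w i) (joint_info M (s \<sigma>) X i ({..<N} - {i}))"
  shows "intermediary_profit M N c w (s \<sigma>) X < 0"
proof -
  define gain where "gain i = (producer_surplus M c (w i) (joint_info M (s \<sigma>) X i {..<N}) (data_info M X {..<N})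
      - producer_surplus M c (w i) (own_info M (s \<sigma>) i) (no_info M))
    - (consumer_surplus M c (w i) (joint_info M (s \<sigma>) X i ({..<N} - {i})) (data_info M X ({..<N} - {i}))
      - consumer_surplus M c (w i) (joint_info M (s \<sigma>) X i {..<N}) (data_info M X {..<N}))" for i
  have neg: "gain i < 0" if i: "i < N" for i
  proof -
    let ?V = "moment2_cond_exp M (w i)"
    let ?B = "{..<N} - {i}"
    let ?SX = "joint_info M (s \<sigma>) X i {..<N}" and ?X = "data_info M X {..<N}"
    let ?SX' = "joint_info M (s \<sigma>) X i ?B" and ?X' = "data_info M X ?B"
    note wi = w_rv[OF i] w_square_integrable[OF i]
    have SX: "subalgebra M ?SX" and X: "subalgebra M ?X" and sub: "sets ?X \<subseteq> sets ?SX"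
      and SX': "subalgebra M ?SX'" and X': "subalgebra M ?X'" and sub': "sets ?X' \<subseteq> sets ?SX'"
      using i data_info_le_joint_info[OF i, of "{..<N}"] data_info_le_joint_info[OF i, of ?B]
      by (auto intro!: joint_info_subalgebra data_info_subalgebra)
    note none = moment2_no_info[OF w_integrable[OF i]]
    have none_sub: "sets (no_info M) \<subseteq> sets (own_info M (s \<sigma>) i)"
      using own_info_subalgebra[OF i, of \<sigma>] sets.top[of "own_info M (s \<sigma>) i"] by (auto simp: no_info_def sigma_sets_empty_eq subalgebra_def)
    have "gain i = (?V ?SX - ?V ?SX') / 2 + 3 / 8 * ?V ?X' - ?V ?X / 8 - \<mu>\<^sup>2 / 4"
      unfolding gain_def
        producer_surplus_eq[OF wi SX X sub] consumer_surplus_eq[OF wi SX X sub]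
        consumer_surplus_eq[OF wi SX' X' sub']
        producer_surplus_eq[OF wi own_info_subalgebra[OF i] none(1) none_sub]
        none(2) w_mean[OF i]
      by (simp add: field_simps)
    \<comment> \<open>Under these bounds the left-hand side is at most \<open>(z - y) / 8\<close>;
      here \<open>z\<close> is \<open>\<mu>\<^sup>2\<close> and \<open>y\<close> is the second
      moment given the full inflow.\<close>
    moreover have "(a - b) / 2 + 3 / 8 * x - y / 8 - z / 4 < 0" if "x \<le> z" "a \<le> b" "z < y" for a b x y z :: real
      using that by (simp add: field_simps)
    ultimately show ?thesis
      using others[OF i] own_data[OF i] data_info_moment_gt[OF i] by simp
  qed
  have "intermediary_profit M N c w (s \<sigma>) X = (\<Sum>i<N. gain i)"
    by (simp add: intermediary_profit_def gain_def sum_subtractf)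
  also have "\<dots> < (\<Sum>i<N. 0)"
    using neg consumers_nonempty by (intro sum_strict_mono) auto
  finally show ?thesis
    by simp
qed

end

end

section \<open>Complete and anonymized data\<close>

context social_data
begin

abbreviation primitive_space :: "(real \<times> (nat \<Rightarrow> real)) measure" where
  "primitive_space \<equiv> borel \<Otimes>\<^sub>M (\<Pi>\<^sub>M j\<in>{..<N}. borel)"

abbreviation primitive_vector :: "'a \<Rightarrow> real \<times> (nat \<Rightarrow> real)" where
  "primitive_vector \<omega> \<equiv> (e \<omega>, \<lambda>j\<in>{..<N}. w j \<omega>)"

lemma primitive_vector_rv: "random_variable primitive_space primitive_vector"
  by (intro measurable_Pair e_rv w_vector_rv)

lemma collected_subset: "collected B \<Longrightarrow> B \<subseteq> {..<N}"
  by auto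

lemma complete_data_rv: "collected B \<Longrightarrow> random_variable (\<Pi>\<^sub>M j\<in>B. borel) (complete_data (s \<sigma>) B)"
  unfolding complete_data_def[abs_def] using collected_subset by (intro measurable_restrict s_rv) auto

lemma perm_permutes:
  assumes "collected B" "\<omega> \<in> space M"
  shows "\<pi> B \<omega> permutes B"
  using measurable_space[OF perm_rv[OF assms(1)] assms(2)] by simp

text \<open>The random index takes finitely many values, so measurability is checked for each fixed
  permutation and then composed with \<open>\<pi> B\<close>.\<close>

lemma anonymized_data_rv:
  assumes B: "collected B"
  shows "random_variable (\<Pi>\<^sub>M j\<in>B. borel) (anonymized_data \<pi> (s \<sigma>) B)"
  unfolding anonymized_data_def[abs_def]
proof (rule measurable_restrict)
  fix j assume j: "j \<in> B"
  have fin: "finite {p. p permutes B}"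
    using collected_subset[OF B] by (intro finite_permutations finite_subset[OF _ finite_lessThan])
  have "(\<lambda>(p, \<omega>). s \<sigma> (p j) \<omega>) \<in> borel_measurable (count_space {p. p permutes B} \<Otimes>\<^sub>M M)"
  proof (intro measurable_pair_measure_countable1 countable_finite fin)
    fix p assume "p \<in> {p. p permutes B}"
    then have "p j < N"
      using j collected_subset[OF B] permutes_in_image[of p B j] by auto
    then show "(\<lambda>\<omega>. case (p, \<omega>) of (p, \<omega>) \<Rightarrow> s \<sigma> (p j) \<omega>) \<in> borel_measurable M"
      by (simp add: s_rv)
  qed
  from measurable_compose[OF measurable_Pair[OF perm_rv[OF B] measurable_ident] this]
  show "random_variable borel (\<lambda>\<omega>. s \<sigma> (\<pi> B \<omega> j) \<omega>)"
    by simp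
qed

lemma sum_complete_data: "(\<Sum>j<N. complete_data (s \<sigma>) {..<N} \<omega> j) = (\<Sum>j<N. s \<sigma> j \<omega>)"
  by (simp add: complete_data_def)

lemma sum_anonymized_data:
  assumes "\<omega> \<in> space M"
  shows "(\<Sum>j<N. anonymized_data \<pi> (s \<sigma>) {..<N} \<omega> j) = (\<Sum>j<N. s \<sigma> j \<omega>)"
  using sum.permute[OF perm_permutes[OF _ assms, of "{..<N}"], of "\<lambda>j. s \<sigma> j \<omega>"]
  by (simp add: anonymized_data_def comp_def)

text \<open>The signals of the others are functions of their fundamentals and of the error, hence
  independent of \<open>w i\<close>.\<close>

lemma complete_data_others:
  assumes i: "i < N"
  shows "moment2_cond_exp M (w i) (data_info M (complete_data (s \<sigma>)) ({..<N} - {i})) \<le> \<mu>\<^sup>2"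
proof -
  define f where "f x = (\<lambda>j\<in>{..<N} - {i}. x j + \<sigma> * x N)" for x :: "nat \<Rightarrow> real"
  have f: "f \<in> measurable (\<Pi>\<^sub>M j\<in>{..N} - {i}. borel) (\<Pi>\<^sub>M j\<in>{..<N} - {i}. borel)"
    unfolding f_def[abs_def] using i
    by (intro measurable_restrict borel_measurable_add borel_measurable_times borel_measurable_const
        measurable_component_singleton) auto
  have eq: "f (\<lambda>j\<in>{..N} - {i}. primitives j \<omega>) = complete_data (s \<sigma>) ({..<N} - {i}) \<omega>" for \<omega>
    using i by (auto simp: f_def complete_data_def signal_def primitives_simps fun_eq_iff)
  have rv: "random_variable (\<Pi>\<^sub>M j\<in>{..<N} - {i}. borel) (complete_data (s \<sigma>) ({..<N} - {i}))"
    using i by (intro complete_data_rv) auto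
  have "indep_set (sets (vimage_algebra (space M) (w i) borel))
      (sets (vimage_algebra (space M) (complete_data (s \<sigma>) ({..<N} - {i})) (\<Pi>\<^sub>M j\<in>{..<N} - {i}. borel)))"
    using indep_set_w_others[OF i f] by (simp only: eq)
  from moment2_cond_exp_indep[OF w_rv[OF i] rv this w_square_integrable[OF i]]
  show ?thesis
    using w_mean[OF i] by (simp add: data_info_def)
qed

text \<open>The own signal fills in the missing coordinate \<open>i\<close>, so
  \<open>S\<^sub>i\<close> and \<open>S\<^sub>-\<^sub>i\<close> already determine the complete
  data.\<close>

lemma complete_data_own:
  assumes i: "i < N"
  shows "moment2_cond_exp M (w i) (joint_info M (s \<sigma>) (complete_data (s \<sigma>)) i {..<N})
    \<le> moment2_cond_exp M (w i) (joint_info M (s \<sigma>) (complete_data (s \<sigma>)) i ({..<N} - {i}))"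
proof (rule moment2_cond_exp_mono[OF w_rv[OF i] w_square_integrable[OF i]])
  let ?B = "{..<N} - {i}"
  let ?f = "\<lambda>p :: real \<times> (nat \<Rightarrow> real). (fst p, \<lambda>j\<in>{..<N}. if j = i then fst p else snd p j)"
  have "?f \<in> measurable (borel \<Otimes>\<^sub>M (\<Pi>\<^sub>M j\<in>?B. borel)) (borel \<Otimes>\<^sub>M (\<Pi>\<^sub>M j\<in>{..<N}. borel))"
  proof (intro measurable_Pair measurable_fst measurable_restrict)
    fix j assume "j \<in> {..<N}"
    then show "(\<lambda>p. if j = i then fst p else snd p j) \<in> borel_measurable (borel \<Otimes>\<^sub>M (\<Pi>\<^sub>M j\<in>?B. borel))"
      by (cases "j = i") (auto intro!: measurable_compose[OF measurable_snd measurable_component_singleton])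
  qed
  from sets_vimage_algebra_compose[of "\<lambda>\<omega>. (s \<sigma> i \<omega>, complete_data (s \<sigma>) ?B \<omega>)", OF _ this, of "space M"]
  have "sets (vimage_algebra (space M) (\<lambda>\<omega>. ?f (s \<sigma> i \<omega>, complete_data (s \<sigma>) ?B \<omega>))
      (borel \<Otimes>\<^sub>M (\<Pi>\<^sub>M j\<in>{..<N}. borel)))
    \<subseteq> sets (joint_info M (s \<sigma>) (complete_data (s \<sigma>)) i ?B)"
    unfolding joint_info_def by (auto simp: complete_data_def space_pair_measure space_PiM)
  moreover have "?f (s \<sigma> i \<omega>, complete_data (s \<sigma>) ?B \<omega>) = (s \<sigma> i \<omega>, complete_data (s \<sigma>) {..<N} \<omega>)" for \<omega>
    by (auto simp: complete_data_def fun_eq_iff)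
  ultimately show "sets (joint_info M (s \<sigma>) (complete_data (s \<sigma>)) i {..<N})
      \<subseteq> sets (joint_info M (s \<sigma>) (complete_data (s \<sigma>)) i ?B)"
    by (simp add: joint_info_def)
  have sub: "subalgebra M (joint_info M (s \<sigma>) (complete_data (s \<sigma>)) i B)" if "collected B" for B
    unfolding joint_info_def by (intro subalgebra_vimage measurable_Pair s_rv complete_data_rv i that)
  show "subalgebra M (joint_info M (s \<sigma>) (complete_data (s \<sigma>)) i {..<N})"
    by (rule sub) simp
  show "subalgebra M (joint_info M (s \<sigma>) (complete_data (s \<sigma>)) i ?B)"
    using i by (intro sub) auto
qed

text \<open>Derandomization applied to the shuffle. The map \<open>\<Psi>\<close> selects what is
  observed, the data alone or the data with the own signal. The hypothesis \<open>avg\<close> asks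
  that each estimator, once averaged over all permutations, be measurable for the information
  \<open>G'\<close> of the comparison.\<close>

lemma anonymized_moment_le:
  fixes \<Psi> :: "real \<times> (nat \<Rightarrow> real) \<Rightarrow> 'k" and K :: "'k measure"
  assumes i: "i < N" and B: "collected B"
    and \<Psi>: "\<Psi> \<in> measurable (borel \<Otimes>\<^sub>M (\<Pi>\<^sub>M j\<in>B. borel)) K"
    and G': "subalgebra M G'"
    and avg: "\<And>\<kappa> :: 'k \<Rightarrow> real. \<kappa> \<in> borel_measurable K \<Longrightarrow>
      (\<lambda>\<omega>. \<Sum>\<tau> | \<tau> permutes B. \<kappa> (\<Psi> (s \<sigma> i \<omega>, \<lambda>j\<in>B. s \<sigma> (\<tau> j) \<omega>))) \<in> borel_measurable G'"
  shows "moment2_cond_exp M (w i)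
      (vimage_algebra (space M) (\<lambda>\<omega>. \<Psi> (s \<sigma> i \<omega>, anonymized_data \<pi> (s \<sigma>) B \<omega>)) K)
    \<le> moment2_cond_exp M (w i) G'"
proof -
  let ?T = "{p. p permutes B}"
  let ?A = "\<lambda>\<omega>. \<Psi> (s \<sigma> i \<omega>, anonymized_data \<pi> (s \<sigma>) B \<omega>)"
  let ?G = "vimage_algebra (space M) ?A K"
  have A: "random_variable K ?A"
    using measurable_compose[OF measurable_Pair[OF s_rv[OF i] anonymized_data_rv[OF B]] \<Psi>] .
  have T: "finite ?T" "?T \<noteq> {}"
    using collected_subset[OF B] permutes_id[of B]
    by (auto intro!: finite_permutations intro: finite_subset simp del: permutes_id)
  obtain \<kappa> where \<kappa>: "\<kappa> \<in> borel_measurable K"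
    and \<kappa>_eq: "\<And>\<omega>. \<omega> \<in> space M \<Longrightarrow> real_cond_exp M ?G (w i) \<omega> = \<kappa> (?A \<omega>)"
    using vimage_algebra_factor[of ?A "space M" K "real_cond_exp M ?G (w i)"] measurable_space[OF A] by auto
  \<comment> \<open>The estimator is rewritten with the permutation \<open>\<tau>\<close> frozen, as
    a function of the primitives; \<open>fst u\<close> is the error and \<open>snd u\<close> the
    vector of fundamentals.\<close>
  define k where "k \<tau> u = \<kappa> (\<Psi> (snd u i + \<sigma> * fst u, \<lambda>j\<in>B. snd u (\<tau> j) + \<sigma> * fst u))"
    for \<tau> :: "nat \<Rightarrow> nat" and u
  have k_eq: "k \<tau> (primitive_vector \<omega>) = \<kappa> (\<Psi> (s \<sigma> i \<omega>, \<lambda>j\<in>B. s \<sigma> (\<tau> j) \<omega>))"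
    if "\<tau> permutes B" for \<tau> \<omega>
  proof -
    have "(\<lambda>j\<in>B. (\<lambda>j\<in>{..<N}. w j \<omega>) (\<tau> j) + \<sigma> * e \<omega>) = (\<lambda>j\<in>B. s \<sigma> (\<tau> j) \<omega>)"
      using permutes_in_image[OF that] collected_subset[OF B]
      by (intro restrict_ext) (auto simp: signal_def)
    then show ?thesis
      using i by (simp add: k_def signal_def)
  qed
  have comp: "(\<lambda>u. snd u j + \<sigma> * fst u) \<in> borel_measurable primitive_space" if "j < N" for j
    using that by (intro borel_measurable_add borel_measurable_times borel_measurable_const measurable_fst
        measurable_compose[OF measurable_snd measurable_component_singleton]) auto
  have "moment2_cond_exp M (\<lambda>\<omega>. (\<lambda>u. snd u i) (primitive_vector \<omega>)) ?G
      \<le> moment2_cond_exp M (\<lambda>\<omega>. (\<lambda>u. snd u i) (primitive_vector \<omega>)) G'"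
  proof (rule moment2_cond_exp_derandomize[OF T perm_rv[OF B] primitive_vector_rv perm_indep[OF B] perm_uniform[OF B]])
    show "(\<lambda>u. snd u i) \<in> borel_measurable primitive_space"
      using i by (intro measurable_compose[OF measurable_snd measurable_component_singleton]) auto
    show "integrable M (\<lambda>\<omega>. (snd (primitive_vector \<omega>) i)\<^sup>2)"
      using i w_square_integrable by simp
    show "subalgebra M ?G"
      using A by (rule subalgebra_vimage)
    show "k \<tau> \<in> borel_measurable primitive_space" if "\<tau> \<in> ?T" for \<tau>
    proof -
      have "\<tau> j < N" if "j \<in> B" for j
        using \<open>\<tau> \<in> ?T\<close> permutes_in_image[of \<tau> B j] that collected_subset[OF B] by auto
      then have "(\<lambda>u. (snd u i + \<sigma> * fst u, \<lambda>j\<in>B. snd u (\<tau> j) + \<sigma> * fst u))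
          \<in> measurable primitive_space (borel \<Otimes>\<^sub>M (\<Pi>\<^sub>M j\<in>B. borel))"
        using i by (intro measurable_Pair measurable_restrict comp)
      from measurable_compose[OF measurable_compose[OF this \<Psi>] \<kappa>] show ?thesis
        by (simp add: k_def[abs_def])
    qed
    show "real_cond_exp M ?G (\<lambda>\<omega>. snd (primitive_vector \<omega>) i) \<omega> = k (\<pi> B \<omega>) (primitive_vector \<omega>)"
      if "\<omega> \<in> space M" for \<omega>
      using \<kappa>_eq[OF that] k_eq[OF perm_permutes[OF B that]] i by (simp add: anonymized_data_def)
    have "(\<lambda>\<omega>. \<Sum>\<tau>\<in>?T. k \<tau> (primitive_vector \<omega>)) \<in> borel_measurable G'"
      using avg[OF \<kappa>] k_eq by simp
    then show "(\<lambda>\<omega>. (\<Sum>\<tau>\<in>?T. k \<tau> (primitive_vector \<omega>)) / card ?T) \<in> borel_measurable G'"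
      by measurable
  qed (rule G')
  then show ?thesis
    using i by simp
qed

text \<open>An average over permutations of \<open>S\<^sub>-\<^sub>i\<close> is a function of
  \<open>S\<^sub>-\<^sub>i\<close>, so the shuffled data predict \<open>w i\<close> no better than
  the complete data of the others.\<close>

lemma anonymized_data_others:
  assumes i: "i < N"
  shows "moment2_cond_exp M (w i) (data_info M (anonymized_data \<pi> (s \<sigma>)) ({..<N} - {i})) \<le> \<mu>\<^sup>2"
proof -
  let ?B = "{..<N} - {i}"
  let ?G' = "data_info M (complete_data (s \<sigma>)) ?B"
  have B: "collected ?B"
    using i by auto
  have G': "subalgebra M ?G'"
    unfolding data_info_def by (intro subalgebra_vimage complete_data_rv B)
  have "moment2_cond_exp M (w i) (vimage_algebra (space M)
      (\<lambda>\<omega>. snd (s \<sigma> i \<omega>, anonymized_data \<pi> (s \<sigma>) ?B \<omega>)) (\<Pi>\<^sub>M j\<in>?B. borel)) \<le> moment2_cond_exp M (w i) ?G'"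
  proof (rule anonymized_moment_le[OF i B measurable_snd G'])
    fix \<kappa> :: "(nat \<Rightarrow> real) \<Rightarrow> real"
    assume \<kappa>: "\<kappa> \<in> borel_measurable (\<Pi>\<^sub>M j\<in>?B. borel)"
    have S: "complete_data (s \<sigma>) ?B \<in> measurable ?G' (\<Pi>\<^sub>M j\<in>?B. borel)"
      unfolding data_info_def using measurable_space[OF complete_data_rv[OF B]]
      by (intro measurable_vimage_algebra1) auto
    have "(\<lambda>\<omega>. \<kappa> (\<lambda>j\<in>?B. complete_data (s \<sigma>) ?B \<omega> (\<tau> j))) \<in> borel_measurable ?G'" if "\<tau> permutes ?B" for \<tau>
      using permutes_in_image[OF that]
      by (intro measurable_compose[OF measurable_restrict \<kappa>]
          measurable_compose[OF S measurable_component_singleton]) auto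
    moreover have "(\<lambda>j\<in>?B. complete_data (s \<sigma>) ?B \<omega> (\<tau> j)) = (\<lambda>j\<in>?B. s \<sigma> (\<tau> j) \<omega>)" if "\<tau> permutes ?B" for \<tau> \<omega>
      using permutes_in_image[OF that] by (intro restrict_ext) (auto simp: complete_data_def)
    ultimately show "(\<lambda>\<omega>. \<Sum>\<tau> | \<tau> permutes ?B. \<kappa> (snd (s \<sigma> i \<omega>, \<lambda>j\<in>?B. s \<sigma> (\<tau> j) \<omega>))) \<in> borel_measurable ?G'"
      by (intro borel_measurable_sum) simp
  qed
  then show ?thesis
    using complete_data_others[OF i, of \<sigma>] by (simp add: data_info_def)
qed

text \<open>The two information sets involve different permutations and need not be nested, so
  monotonicity alone does not apply. The averaged estimator, however, is symmetric in the data
  entries, and any arrangement of all signals suffices to evaluate it.\<close>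

lemma anonymized_data_own:
  assumes i: "i < N"
  shows "moment2_cond_exp M (w i) (joint_info M (s \<sigma>) (anonymized_data \<pi> (s \<sigma>)) i {..<N})
    \<le> moment2_cond_exp M (w i) (joint_info M (s \<sigma>) (anonymized_data \<pi> (s \<sigma>)) i ({..<N} - {i}))"
proof -
  let ?B = "{..<N}" and ?B' = "{..<N} - {i}"
  let ?A' = "anonymized_data \<pi> (s \<sigma>) ?B'"
  let ?G' = "joint_info M (s \<sigma>) (anonymized_data \<pi> (s \<sigma>)) i ?B'"
  have B: "collected ?B" and B': "collected ?B'"
    using i by auto
  have rv: "random_variable (borel \<Otimes>\<^sub>M (\<Pi>\<^sub>M j\<in>?B'. borel)) (\<lambda>\<omega>. (s \<sigma> i \<omega>, ?A' \<omega>))"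
    by (intro measurable_Pair s_rv anonymized_data_rv i B')
  have G': "subalgebra M ?G'"
    unfolding joint_info_def using rv by (rule subalgebra_vimage)
  have pair: "(\<lambda>\<omega>. (s \<sigma> i \<omega>, ?A' \<omega>)) \<in> measurable ?G' (borel \<Otimes>\<^sub>M (\<Pi>\<^sub>M j\<in>?B'. borel))"
    unfolding joint_info_def using measurable_space[OF rv] by (intro measurable_vimage_algebra1) auto
  have "moment2_cond_exp M (w i) (vimage_algebra (space M)
      (\<lambda>\<omega>. (s \<sigma> i \<omega>, anonymized_data \<pi> (s \<sigma>) ?B \<omega>)) (borel \<Otimes>\<^sub>M (\<Pi>\<^sub>M j\<in>?B. borel)))
    \<le> moment2_cond_exp M (w i) ?G'"
  proof (rule anonymized_moment_le[where \<Psi> = "\<lambda>p. p", OF i B measurable_ident_sets[OF refl] G'])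
    fix \<kappa> :: "real \<times> (nat \<Rightarrow> real) \<Rightarrow> real"
    assume \<kappa>: "\<kappa> \<in> borel_measurable (borel \<Otimes>\<^sub>M (\<Pi>\<^sub>M j\<in>?B. borel))"
    \<comment> \<open>The averaged estimator as a function of the own signal and the data of the
      others, with the own signal inserted at coordinate \<open>i\<close>.\<close>
    let ?\<psi> = "\<lambda>p. \<Sum>\<tau> | \<tau> permutes ?B. \<kappa> (fst p, \<lambda>j\<in>?B. if \<tau> j = i then fst p else snd p (\<tau> j))"
    have "?\<psi> \<in> borel_measurable (borel \<Otimes>\<^sub>M (\<Pi>\<^sub>M j\<in>?B'. borel))"
    proof (intro borel_measurable_sum measurable_compose[OF _ \<kappa>] measurable_Pair measurable_fst measurable_restrict)
      fix \<tau> j assume "\<tau> \<in> {\<tau>. \<tau> permutes ?B}" "j \<in> ?B"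
      then have "\<tau> j \<in> ?B"
        using permutes_in_image by fastforce
      then show "(\<lambda>p. if \<tau> j = i then fst p else snd p (\<tau> j)) \<in> borel_measurable (borel \<Otimes>\<^sub>M (\<Pi>\<^sub>M j\<in>?B'. borel))"
        by (cases "\<tau> j = i") (auto intro!: measurable_compose[OF measurable_snd measurable_component_singleton])
    qed
    from measurable_compose[OF pair this]
    have "(\<lambda>\<omega>. ?\<psi> (s \<sigma> i \<omega>, ?A' \<omega>)) \<in> borel_measurable ?G'" .
    moreover have "?\<psi> (s \<sigma> i \<omega>, ?A' \<omega>) = (\<Sum>\<tau> | \<tau> permutes ?B. \<kappa> (s \<sigma> i \<omega>, \<lambda>j\<in>?B. s \<sigma> (\<tau> j) \<omega>))"
      if "\<omega> \<in> space ?G'" for \<omega>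
    proof -
      have perm: "\<pi> ?B' \<omega> permutes ?B'"
        using that G' by (intro perm_permutes[OF B']) (simp add: subalgebra_def)
      then have perm_B: "\<pi> ?B' \<omega> permutes ?B"
        by (rule permutes_subset) auto
      have fix_i: "\<pi> ?B' \<omega> i = i"
        using perm by (rule permutes_not_in) simp
      \<comment> \<open>\<open>A\<^sub>-\<^sub>i\<close> extended by \<open>S\<^sub>i\<close> at \<open>i\<close> is itself a permutation of all signals, over which the sum is invariant.\<close>
      have "(\<lambda>j\<in>?B. if \<tau> j = i then s \<sigma> i \<omega> else ?A' \<omega> (\<tau> j)) = (\<lambda>j\<in>?B. s \<sigma> ((\<pi> ?B' \<omega> \<circ> \<tau>) j) \<omega>)"
        if "\<tau> permutes ?B" for \<tau>
        using permutes_in_image[OF that] fix_i by (intro restrict_ext) (auto simp: anonymized_data_def)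
      then have "?\<psi> (s \<sigma> i \<omega>, ?A' \<omega>)
          = (\<Sum>\<tau> | \<tau> permutes ?B. \<kappa> (s \<sigma> i \<omega>, \<lambda>j\<in>?B. s \<sigma> ((\<pi> ?B' \<omega> \<circ> \<tau>) j) \<omega>))"
        unfolding fst_conv snd_conv by (intro sum.cong refl) simp
      also have "\<dots> = (\<Sum>\<tau> | \<tau> permutes ?B. \<kappa> (s \<sigma> i \<omega>, \<lambda>j\<in>?B. s \<sigma> (\<tau> j) \<omega>))"
        by (rule setum_permutations_compose_left[OF perm_B, symmetric])
      finally show ?thesis .
    qed
    ultimately show "(\<lambda>\<omega>. \<Sum>\<tau> | \<tau> permutes ?B. \<kappa> (s \<sigma> i \<omega>, \<lambda>j\<in>?B. s \<sigma> (\<tau> j) \<omega>)) \<in> borel_measurable ?G'"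
      by (simp only: cong: measurable_cong)
  qed
  then show ?thesis
    by (simp add: joint_info_def)
qed

lemma own_info_moment_eventually:
  assumes i: "i < N" and ac: "absolutely_continuous lborel (distr M borel e)"
  shows "\<forall>\<^sub>F \<sigma> in at_top. moment2_cond_exp M (w i) (own_info M (s \<sigma>) i) < \<mu>\<^sup>2 + 3 / 8"
  using moment2_cond_exp_large_noise[OF w_rv[OF i] e_rv indep_w_e[OF i] w_square_integrable[OF i] ac, of "3 / 8"]
  by (simp add: own_info_def signal_def[abs_def] w_mean[OF i])

lemma intermediary_profit_complete:
  "intermediary_profit M N c w (s \<sigma>) (complete_data (s \<sigma>)) < 0"
  by (intro intermediary_profit_neg complete_data_rv sum_complete_data complete_data_others complete_data_own)

lemma intermediary_profit_anonymized:
  "intermediary_profit M N c w (s \<sigma>) (anonymized_data \<pi> (s \<sigma>)) < 0"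
  by (intro intermediary_profit_neg anonymized_data_rv sum_anonymized_data anonymized_data_others anonymized_data_own)

lemma social_surplus_gain_large_noise:
  assumes ac: "absolutely_continuous lborel (distr M borel e)"
  shows "\<exists>\<sigma>\<^sub>0>0. \<forall>\<sigma>>\<sigma>\<^sub>0. \<forall>i<N.
    social_surplus_gain M N c w (s \<sigma>) (complete_data (s \<sigma>)) i > 0 \<and>
    social_surplus_gain M N c w (s \<sigma>) (anonymized_data \<pi> (s \<sigma>)) i > 0"
proof -
  \<comment> \<open>There are finitely many consumers, so one threshold serves them all; as the
    bound concerns own signals only, it also serves both policies.\<close>
  have "\<forall>\<^sub>F \<sigma> in at_top. \<forall>i\<in>{..<N}. moment2_cond_exp M (w i) (own_info M (s \<sigma>) i) < \<mu>\<^sup>2 + 3 / 8"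
    using own_info_moment_eventually[OF _ ac] by (intro eventually_ball_finite) auto
  then obtain \<sigma>\<^sub>1 where "\<And>\<sigma> i. \<sigma>\<^sub>1 \<le> \<sigma> \<Longrightarrow> i < N \<Longrightarrow>
      moment2_cond_exp M (w i) (own_info M (s \<sigma>) i) < \<mu>\<^sup>2 + 3 / 8"
    by (auto simp: eventually_at_top_linorder)
  then show ?thesis
    \<comment> \<open>The maximum with 1 makes the threshold positive.\<close>
    by (intro exI[of _ "max 1 \<sigma>\<^sub>1"])
      (auto intro!: social_surplus_gain_pos complete_data_rv sum_complete_data anonymized_data_rv sum_anonymized_data)
qed

end

theorem corollary3:
  fixes M :: "'a measure" and N :: nat and w :: "nat \<Rightarrow> 'a \<Rightarrow> real" and e :: "'a \<Rightarrow> real"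
    and \<pi> :: "nat set \<Rightarrow> 'a \<Rightarrow> nat \<Rightarrow> nat" and \<mu> c :: real
  assumes "social_data M N w e \<pi> \<mu> c"
  shows "(absolutely_continuous lborel (distr M borel e) \<longrightarrow>
      (\<exists>\<sigma>\<^sub>0>0. \<forall>\<sigma>>\<sigma>\<^sub>0. \<forall>i<N.
        social_surplus_gain M N c w (signal w e \<sigma>) (complete_data (signal w e \<sigma>)) i > 0 \<and>
        social_surplus_gain M N c w (signal w e \<sigma>) (anonymized_data \<pi> (signal w e \<sigma>)) i > 0))
    \<and> (\<forall>\<sigma>>0.
        intermediary_profit M N c w (signal w e \<sigma>) (complete_data (signal w e \<sigma>)) < 0 \<and>
        intermediary_profit M N c w (signal w e \<sigma>) (anonymized_data \<pi> (signal w e \<sigma>)) < 0)"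
proof -
  interpret social_data M N w e \<pi> \<mu> c
    by fact
  show ?thesis
    using social_surplus_gain_large_noise intermediary_profit_complete intermediary_profit_anonymized by blast
qed

end
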